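(* Let $(R,\mathfrak{m})$ be a one-dimensional Noetherian local ring and $I\subseteq R$ an ideal. Then there exist integers $a$ and $b$ such that for all integers $n\gg0$, $$\lambda_R\left(H^0_{\mathfrak{m}}(R/I^n)\right)=an+b.$$
   Context: $\lambda_R(N)$ denotes the length of a finite length $R$-module $N$, and $H^0_{\mathfrak{m}}(-)$ is zeroth local cohomology with respect to $\mathfrak{m}$. *)

theory Defs
  imports "HOL-Algebra.Algebra" "HOL-Library.Extended_Nat"
begin

locale local_ring = cring R + maximalideal \<mm> R for R (structure) and \<mm> +
  assumes maximalideal_unique: "maximalideal J R \<Longrightarrow> J = \<mm>"

text \<open>Supremum of the lengths \<open>n\<close> of the strict chains \<open>C 0 \<subset> C 1 \<subset> \<dots> \<subset> C n\<close> in a family of sets.\<close>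

definition chain_height :: "'a set set \<Rightarrow> enat" where
  "chain_height \<S> =
     Sup {enat n | n. \<exists>C :: nat \<Rightarrow> 'a set. (\<forall>i\<le>n. C i \<in> \<S>) \<and> (\<forall>i<n. C i \<subset> C (Suc i))}"

text \<open>The zero ring, which has no prime ideal, gets dimension 0; local rings are nonzero.\<close>

definition krull_dim :: "('a, 'b) ring_scheme \<Rightarrow> enat" where
  "krull_dim R = chain_height {P. primeideal P R}"

definition module_length :: "('a, 'b) ring_scheme \<Rightarrow> ('a, 'c, 'd) module_scheme \<Rightarrow> enat" where
  "module_length R M = chain_height {N. submodule N R M}"

text \<open>The \<open>R\<close>-module \<open>R/J\<close>: the quotient ring with scalars acting through \<open>R \<rightarrow> R/J\<close>.\<close>

definition quot_module :: "('a, 'b) ring_scheme \<Rightarrow> 'a set \<Rightarrow> ('a, 'a set) module" where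
  "quot_module R J =
     ring.extend (R Quot J) (module.fields (\<lambda>r A. (J +>\<^bsub>R\<^esub> r) \<otimes>\<^bsub>R Quot J\<^esub> A))"

text \<open>\<open>H\<^sup>0\<^sub>J(M)\<close>, the submodule of the elements killed by some power of \<open>J\<close>. Powers of ideals are
  powers in the multiplicative monoid of \<^const>\<open>ideals_set\<close>, so \<open>J\<^sup>0 = R\<close>.\<close>

definition local_cohomology0 ::
  "('a, 'b) ring_scheme \<Rightarrow> 'a set \<Rightarrow> ('a, 'c, 'd) module_scheme \<Rightarrow> ('a, 'c, 'd) module_scheme" where
  "local_cohomology0 R J M =
     M\<lparr>carrier := {x \<in> carrier M. \<exists>k :: nat. \<forall>a \<in> J [^]\<^bsub>ideals_set R\<^esub> k. a \<odot>\<^bsub>M\<^esub> x = \<zero>\<^bsub>M\<^esub>}\<rparr>"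

lemma quot_module_simps [simp]:
  "carrier (quot_module R J) = carrier (R Quot J)"
  "monoid.mult (quot_module R J) = monoid.mult (R Quot J)"
  "\<one>\<^bsub>quot_module R J\<^esub> = \<one>\<^bsub>R Quot J\<^esub>"
  "\<zero>\<^bsub>quot_module R J\<^esub> = \<zero>\<^bsub>R Quot J\<^esub>"
  "ring.add (quot_module R J) = ring.add (R Quot J)"
  "r \<odot>\<^bsub>quot_module R J\<^esub> A = (J +>\<^bsub>R\<^esub> r) \<otimes>\<^bsub>R Quot J\<^esub> A"
  by (simp_all add: quot_module_def ring.defs module.defs)

lemma module_quot_module:
  assumes "cring R" "ideal J R"
  shows "module R (quot_module R J)"
proof -
  interpret R: cring R by fact
  interpret J: ideal J R by fact
  interpret Q: cring "R Quot J" using J.quotient_is_cring[OF assms(1)] .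
  have hom: "(+>\<^bsub>R\<^esub>) J \<in> ring_hom R (R Quot J)" by (rule J.rcos_ring_hom)
  note h = ring_hom_closed[OF hom] ring_hom_add[OF hom] ring_hom_mult[OF hom] ring_hom_one[OF hom]
  have ag: "abelian_group (quot_module R J)"
  proof (rule abelian_groupI)
    fix A assume "A \<in> carrier (quot_module R J)"
    hence "A \<in> carrier (R Quot J)" by simp
    hence "\<ominus>\<^bsub>R Quot J\<^esub> A \<in> carrier (R Quot J)" "\<ominus>\<^bsub>R Quot J\<^esub> A \<oplus>\<^bsub>R Quot J\<^esub> A = \<zero>\<^bsub>R Quot J\<^esub>"
      by (rule Q.a_inv_closed, rule Q.l_neg)
    thus "\<exists>B\<in>carrier (quot_module R J). B \<oplus>\<^bsub>quot_module R J\<^esub> A = \<zero>\<^bsub>quot_module R J\<^esub>"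
      unfolding quot_module_simps by blast
  qed (simp_all add: Q.a_ac)
  show ?thesis
    by (rule moduleI[OF assms(1) ag]) (simp_all add: h Q.l_distr Q.r_distr Q.m_assoc)
qed

lemma ideals_set_pow_ideal:
  assumes "cring R" "ideal J R"
  shows "ideal (J [^]\<^bsub>ideals_set R\<^esub> (k::nat)) R"
proof -
  interpret R: cring R by fact
  interpret S: comm_monoid "ideals_set R" by (rule R.ideals_set_is_comm_monoid)
  show ?thesis using S.nat_pow_closed[of J k] assms(2) by (simp add: ideals_set_def)
qed

lemma ideals_set_pow_antimono:
  assumes "cring R" "ideal J R" "k \<le> (l::nat)"
  shows "J [^]\<^bsub>ideals_set R\<^esub> l \<subseteq> J [^]\<^bsub>ideals_set R\<^esub> k"
  using assms(3)
proof (induction l rule: dec_induct)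
  case base show ?case by simp
next
  case (step l)
  interpret R: cring R by fact
  have "J [^]\<^bsub>ideals_set R\<^esub> Suc l = ideal_prod R (J [^]\<^bsub>ideals_set R\<^esub> l) J"
    by (simp add: nat_pow_def ideals_set_def)
  also have "\<dots> \<subseteq> J [^]\<^bsub>ideals_set R\<^esub> l"
    using R.ideal_prod_inter[OF ideals_set_pow_ideal[OF assms(1,2)] assms(2)] by blast
  finally show ?case using step.IH by blast
qed

lemma submodule_local_cohomology0:
  assumes "module R M" "ideal J R"
  shows "submodule (carrier (local_cohomology0 R J M)) R M"
proof -
  interpret module R M by fact
  have cr: "cring R" by (rule R.is_cring)
  have sub: "a \<in> carrier R" if "a \<in> J [^]\<^bsub>ideals_set R\<^esub> (k::nat)" for a k
    using ideals_set_pow_ideal[OF cr assms(2)] that ideal.Icarr by metis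
  show ?thesis
  proof (rule submoduleI)
    fix x y assume x: "x \<in> carrier (local_cohomology0 R J M)" and y: "y \<in> carrier (local_cohomology0 R J M)"
    then obtain k l :: nat where
      k: "\<forall>a \<in> J [^]\<^bsub>ideals_set R\<^esub> k. a \<odot>\<^bsub>M\<^esub> x = \<zero>\<^bsub>M\<^esub>" and
      l: "\<forall>a \<in> J [^]\<^bsub>ideals_set R\<^esub> l. a \<odot>\<^bsub>M\<^esub> y = \<zero>\<^bsub>M\<^esub>" and
      c: "x \<in> carrier M" "y \<in> carrier M"
      by (auto simp: local_cohomology0_def)
    have "a \<odot>\<^bsub>M\<^esub> (x \<oplus>\<^bsub>M\<^esub> y) = \<zero>\<^bsub>M\<^esub>" if a: "a \<in> J [^]\<^bsub>ideals_set R\<^esub> (max k l)" for a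
    proof -
      have "a \<in> J [^]\<^bsub>ideals_set R\<^esub> k" "a \<in> J [^]\<^bsub>ideals_set R\<^esub> l"
        using a ideals_set_pow_antimono[OF cr assms(2), of k "max k l"]
          ideals_set_pow_antimono[OF cr assms(2), of l "max k l"] by auto
      thus ?thesis using k l c sub[OF a] by (simp add: smult_r_distr)
    qed
    thus "x \<oplus>\<^bsub>M\<^esub> y \<in> carrier (local_cohomology0 R J M)"
      using c unfolding local_cohomology0_def by auto
  next
    fix x assume "x \<in> carrier (local_cohomology0 R J M)"
    thus "\<ominus>\<^bsub>M\<^esub> x \<in> carrier (local_cohomology0 R J M)"
      using sub by (force simp: local_cohomology0_def smult_r_minus)
  next
    fix r x assume r: "r \<in> carrier R" and x: "x \<in> carrier (local_cohomology0 R J M)"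
    have "a \<odot>\<^bsub>M\<^esub> (r \<odot>\<^bsub>M\<^esub> x) = \<zero>\<^bsub>M\<^esub>" if "a \<in> carrier R" "a \<odot>\<^bsub>M\<^esub> x = \<zero>\<^bsub>M\<^esub>" "x \<in> carrier M" for a
    proof -
      have "a \<odot>\<^bsub>M\<^esub> (r \<odot>\<^bsub>M\<^esub> x) = r \<odot>\<^bsub>M\<^esub> (a \<odot>\<^bsub>M\<^esub> x)"
        using that r by (metis smult_assoc1 R.m_comm)
      thus ?thesis using that r by simp
    qed
    thus "r \<odot>\<^bsub>M\<^esub> x \<in> carrier (local_cohomology0 R J M)"
      using r x sub by (fastforce simp: local_cohomology0_def)
  qed (auto simp: local_cohomology0_def sub)
qed

end

theory Submission
  imports Defs
begin

text \<open>Let \<open>S\<^sub>n\<close> be the saturation of \<open>I\<^sup>n\<close>, so that the length in question is \<open>\<lambda>(S\<^sub>n/I\<^sup>n)\<close>.  As \<open>R\<close> has dimension one,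
  there is a parameter \<open>z \<in> \<mm>\<close> with \<open>\<mm>\<^sup>c \<subseteq> zR\<close>.  Since \<open>S\<^sub>n \<inter> zR = zS\<^sub>n\<close>, the descending chain \<open>S\<^sub>n\<close> becomes
  stationary once the chain \<open>S\<^sub>n + zR\<close> does, by Nakayama.  From then on the length grows by
  \<open>h n = \<lambda>(I\<^sup>n/I\<^sup>n\<^sup>+\<^sup>1)\<close> in each step, and it remains to see that \<open>h\<close> is eventually constant.  It suffices to find,
  for all large \<open>d\<close>, an element \<open>x\<close> with \<open>I\<^sup>n\<^sup>+\<^sup>d = xI\<^sup>n\<close> for large \<open>n\<close>: multiplication by \<open>x\<close> then gives
  \<open>h (n + d) \<le> h n\<close>, and this for two consecutive \<open>d\<close> forces \<open>h\<close> to be eventually constant.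

  The residue field may be finite, so \<open>x\<close> cannot be chosen as a general element of \<open>I\<close>.
  Instead, consider the fiber cone \<open>\<Oplus> I\<^sup>n/\<mm>I\<^sup>n\<close>, whose pieces have length at most \<open>e = \<lambda>(R/zR)\<close>, and a
  family of pairwise orthogonal, non-nilpotent elements of the same degree.  Such a family has at most
  \<open>e\<close> members and can be moved to any larger degree \<open>d\<close>.  Let \<open>x\<close> be the sum of a family of maximal size.
  An element annihilated by a power of \<open>x\<close> is nilpotent, for otherwise a power of it would enlarge the
  family.  A Fitting decomposition with respect to \<open>x\<close> then shows that \<open>I\<close> is nilpotent modulo \<open>x\<close> in the
  fiber cone, and Nakayama's lemma lifts this to \<open>I\<^sup>n\<^sup>+\<^sup>d = xI\<^sup>n\<close>.\<close>

no_notation Sum_Type.Plus (infixr "<+>" 65)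

section \<open>Heights of families of sets\<close>

lemma chain_height_leI:
  assumes "\<And>n C. \<lbrakk>\<And>i. i \<le> n \<Longrightarrow> C i \<in> \<S>; \<And>i. i < n \<Longrightarrow> C i \<subset> C (Suc i)\<rbrakk> \<Longrightarrow> enat n \<le> b"
  shows "chain_height \<S> \<le> b"
  unfolding chain_height_def by (rule Sup_least) (use assms in auto)

lemma le_chain_heightI:
  fixes C :: "nat \<Rightarrow> 'a set"
  assumes "\<And>i. i \<le> n \<Longrightarrow> C i \<in> \<S>" "\<And>i. i < n \<Longrightarrow> C i \<subset> C (Suc i)"
  shows "enat n \<le> chain_height \<S>"
  unfolding chain_height_def by (rule Sup_upper) (use assms in blast)

text \<open>A supremum above \<open>n - 1\<close> is witnessed by a member above
  \<open>n - 1\<close>, and a longer chain can be cut off at \<open>n\<close>. Nonemptiness supplies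
  the one-term chain for \<open>n = 0\<close>.\<close>

lemma chain_height_ge_iff:
  assumes "\<S> \<noteq> {}"
  shows "enat n \<le> chain_height \<S> \<longleftrightarrow>
    (\<exists>C :: nat \<Rightarrow> 'a set. (\<forall>i\<le>n. C i \<in> \<S>) \<and> (\<forall>i<n. C i \<subset> C (Suc i)))" (is "?L = ?R")
proof
  assume L: ?L
  show ?R
  proof (cases n)
    case 0
    from assms obtain A where "A \<in> \<S>" by blast
    thus ?thesis using 0 by (intro exI[of _ "\<lambda>_. A"]) auto
  next
    case (Suc k)
    have "enat k < chain_height \<S>" using L Suc
      by (metis Suc_ile_eq)
    then obtain y where "enat k < y" and y: "y \<in> {enat n | n. \<exists>C :: nat \<Rightarrow> 'a set. (\<forall>i\<le>n. C i \<in> \<S>) \<and> (\<forall>i<n. C i \<subset> C (Suc i))}"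
      unfolding chain_height_def less_Sup_iff by blast
    then obtain m and C :: "nat \<Rightarrow> 'a set" where "k < m" "\<forall>i\<le>m. C i \<in> \<S>" "\<forall>i<m. C i \<subset> C (Suc i)" by auto
    thus ?thesis using Suc by (intro exI[of _ C]) auto
  qed
next
  assume ?R
  then obtain C :: "nat \<Rightarrow> 'a set" where "\<forall>i\<le>n. C i \<in> \<S>" "\<forall>i<n. C i \<subset> C (Suc i)" by blast
  thus ?L by (intro le_chain_heightI[of n C]) auto
qed

lemma chain_height_le:
  assumes "\<And>A. A \<in> \<S> \<Longrightarrow> f A \<in> \<T>"
    and "\<And>A B. A \<in> \<S> \<Longrightarrow> B \<in> \<S> \<Longrightarrow> A \<subset> B \<Longrightarrow> f A \<subset> f B"
  shows "chain_height \<S> \<le> chain_height \<T>"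
proof (rule chain_height_leI)
  fix n and C :: "nat \<Rightarrow> 'a set"
  assume C: "\<And>i. i \<le> n \<Longrightarrow> C i \<in> \<S>" "\<And>i. i < n \<Longrightarrow> C i \<subset> C (Suc i)"
  show "enat n \<le> chain_height \<T>"
    by (rule le_chain_heightI[of _ "\<lambda>i. f (C i)"]) (use assms C in auto)
qed

lemma chain_height_mono: "\<S> \<subseteq> \<T> \<Longrightarrow> chain_height \<S> \<le> chain_height \<T>"
  by (rule chain_height_le[of _ id]) auto

text \<open>Deleting the repetitions from a weakly ascending chain leaves a strict one. This is
  applied to images of a strict chain under maps that preserve inclusions but not
  strictness.\<close>

lemma card_strict_steps_le_chain_height:
  fixes C :: "nat \<Rightarrow> 'a set"
  assumes "\<And>i. i \<le> n \<Longrightarrow> C i \<in> \<S>" "\<And>i. i < n \<Longrightarrow> C i \<subseteq> C (Suc i)"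
  shows "enat (card {i. i < n \<and> C i \<noteq> C (Suc i)}) \<le> chain_height \<S>"
proof -
  \<comment> \<open>The thinned chain ends in \<open>C k\<close>, so that a strict next step can be
    appended to it.\<close>
  have "\<exists>D. (\<forall>i\<le>card {i. i < k \<and> C i \<noteq> C (Suc i)}. D i \<in> \<S>) \<and>
       (\<forall>i<card {i. i < k \<and> C i \<noteq> C (Suc i)}. D i \<subset> D (Suc i)) \<and>
       D (card {i. i < k \<and> C i \<noteq> C (Suc i)}) = C k" if "k \<le> n" for k
    using that
  proof (induction k)
    case 0
    show ?case using assms(1)[of 0] by (intro exI[of _ "\<lambda>_. C 0"]) auto
  next
    case (Suc k)
    define c where "c = card {i. i < k \<and> C i \<noteq> C (Suc i)}"
    from Suc obtain D where D: "\<forall>i\<le>c. D i \<in> \<S>" "\<forall>i<c. D i \<subset> D (Suc i)" "D c = C k"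
      unfolding c_def by auto
    show ?case
    proof (cases "C k = C (Suc k)")
      case True
      have "{i. i < Suc k \<and> C i \<noteq> C (Suc i)} = {i. i < k \<and> C i \<noteq> C (Suc i)}"
        using True less_Suc_eq by auto
      thus ?thesis using D True unfolding c_def by (intro exI[of _ D]) auto
    next
      case False
      have "{i. i < Suc k \<and> C i \<noteq> C (Suc i)} = insert k {i. i < k \<and> C i \<noteq> C (Suc i)}"
        using False less_Suc_eq by auto
      hence c: "card {i. i < Suc k \<and> C i \<noteq> C (Suc i)} = Suc c" unfolding c_def by simp
      have "C k \<subset> C (Suc k)" using False assms(2)[of k] Suc.prems by auto
      thus ?thesis unfolding c using D assms(1)[OF Suc.prems]
        by (intro exI[of _ "\<lambda>i. if i \<le> c then D i else C (Suc k)"]) (auto simp: less_Suc_eq)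
    qed
  qed
  from this[of n] obtain D where
    "\<forall>i\<le>card {i. i < n \<and> C i \<noteq> C (Suc i)}. D i \<in> \<S>"
    "\<forall>i<card {i. i < n \<and> C i \<noteq> C (Suc i)}. D i \<subset> D (Suc i)" by blast
  thus ?thesis by (intro le_chain_heightI[of _ D]) auto
qed

lemma enat_leI_le:
  fixes a b :: enat
  assumes "\<And>k. enat k \<le> a \<Longrightarrow> enat k \<le> b"
  shows "a \<le> b"
proof (cases a)
  case infinity
  have "b = \<infinity>"
  proof (cases b)
    case (enat m)
    thus ?thesis using assms[of "Suc m"] infinity by simp
  qed
  thus ?thesis by simp
qed (use assms in blast)

lemma enat_le_add_split:
  fixes a b :: enat
  assumes "enat k \<le> a + b"
  obtains i j where "k = i + j" "enat i \<le> a" "enat j \<le> b"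
proof (cases "enat k \<le> a")
  case True
  thus ?thesis using that[of k 0] by (simp add: zero_enat_def[symmetric])
next
  case False
  then obtain n where n: "a = enat n" "n < k" by (cases a) auto
  have "enat (k - n) \<le> b" using assms n by (cases b) auto
  thus ?thesis using that[of n "k - n"] n by auto
qed

section \<open>Lengths of intervals of ideals\<close>

context cring
begin

lemma add_left_subset:
  assumes "ideal A R" "ideal B R"
  shows "A \<subseteq> A <+> B"
proof
  fix a assume a: "a \<in> A"
  have "a = a \<oplus> \<zero>" "\<zero> \<in> B"
    using ideal.Icarr[OF assms(1) a] additive_subgroup.zero_closed[OF ideal.axioms(1)[OF assms(2)]] by auto
  thus "a \<in> A <+> B" using a unfolding set_add_def' by blast
qed

lemma add_right_subset: "ideal A R \<Longrightarrow> ideal B R \<Longrightarrow> B \<subseteq> A <+> B"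
  using add_left_subset[of B A] set_add_comm[of A B] ideal.Icarr by (metis subsetI)

lemma set_add_memE:
  assumes "x \<in> A <+> B" obtains a b where "a \<in> A" "b \<in> B" "x = a \<oplus> b"
proof -
  from assms have "\<exists>a\<in>A. \<exists>b\<in>B. x = a \<oplus> b" unfolding set_add_def' by blast
  thus thesis using that by (elim bexE)
qed

lemma set_add_memI: "a \<in> A \<Longrightarrow> b \<in> B \<Longrightarrow> a \<oplus> b \<in> A <+> B"
  unfolding set_add_def' by auto

lemma add_ideals_least:
  assumes "ideal C R" "A \<subseteq> C" "B \<subseteq> C"
  shows "A <+> B \<subseteq> C"
proof
  fix x assume "x \<in> A <+> B"
  then obtain a b where "a \<in> A" "b \<in> B" "x = a \<oplus> b" by (rule set_add_memE)
  thus "x \<in> C" using assms additive_subgroup.a_closed[OF ideal.axioms(1)[OF assms(1)]] by auto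
qed

lemma ideal_minusD:
  assumes "ideal A R" "a \<in> A" "a \<oplus> b \<in> A" "b \<in> carrier R"
  shows "b \<in> A"
proof -
  interpret A: ideal A R by fact
  have "b = \<ominus> a \<oplus> (a \<oplus> b)" using A.Icarr[OF assms(2)] assms(4) by (simp add: r_neg1)
  thus ?thesis using A.a_closed[OF A.a_inv_closed[OF assms(2)] assms(3)] by simp
qed

lemma ideal_prod_least:
  assumes "ideal C R" "\<And>a b. a \<in> A \<Longrightarrow> b \<in> B \<Longrightarrow> a \<otimes> b \<in> C"
  shows "A \<cdot> B \<subseteq> C"
proof
  fix s assume "s \<in> A \<cdot> B"
  thus "s \<in> C" by induction (use assms additive_subgroup.a_closed[OF ideal.axioms(1)] in auto)
qed

lemma cring_idealI:
  assumes "A \<subseteq> carrier R" "\<zero> \<in> A" "\<And>a b. a \<in> A \<Longrightarrow> b \<in> A \<Longrightarrow> a \<oplus> b \<in> A"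
    and "\<And>a r. a \<in> A \<Longrightarrow> r \<in> carrier R \<Longrightarrow> r \<otimes> a \<in> A"
  shows "ideal A R"
proof (rule idealI[OF ring_axioms])
  show "subgroup A (add_monoid R)"
  proof (rule add.subgroupI)
    fix a assume a: "a \<in> A"
    have "\<ominus> a = (\<ominus> \<one>) \<otimes> a" using a assms(1) by (simp add: l_minus subset_iff)
    thus "\<ominus> a \<in> A" using assms(4)[OF a, of "\<ominus> \<one>"] by simp
  qed (use assms in auto)
  show "\<And>a x. \<lbrakk>a \<in> A; x \<in> carrier R\<rbrakk> \<Longrightarrow> x \<otimes> a \<in> A" using assms by auto
  show "\<And>a x. \<lbrakk>a \<in> A; x \<in> carrier R\<rbrakk> \<Longrightarrow> a \<otimes> x \<in> A" using assms m_comm by (metis subsetD)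
qed

section \<open>Multiples and colon ideals\<close>

abbreviation scale :: "'a \<Rightarrow> 'a set \<Rightarrow> 'a set" where
  "scale x A \<equiv> (\<lambda>a. x \<otimes> a) ` A"

lemma scale_ideal:
  assumes x: "x \<in> carrier R" and A: "ideal A R"
  shows "ideal (scale x A) R"
proof -
  interpret A: ideal A R by fact
  show ?thesis
  proof (rule cring_idealI)
    show "\<zero> \<in> scale x A" using x A.zero_closed by (metis image_eqI r_null)
    fix a b assume "a \<in> scale x A" "b \<in> scale x A"
    then obtain c d where "c \<in> A" "d \<in> A" "a = x \<otimes> c" "b = x \<otimes> d" by auto
    thus "a \<oplus> b \<in> scale x A" using x A.a_closed A.Icarr by (metis image_eqI r_distr)
  next
    fix a r assume "a \<in> scale x A" "r \<in> carrier R"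
    then obtain c where "c \<in> A" "a = x \<otimes> c" by auto
    thus "r \<otimes> a \<in> scale x A" using x A.Icarr A.I_l_closed[of c r] \<open>r \<in> carrier R\<close>
      by (intro image_eqI[of _ _ "r \<otimes> c"]) (auto simp: m_lcomm)
  qed (use x A.Icarr in auto)
qed

lemma scale_subset: "x \<in> carrier R \<Longrightarrow> ideal A R \<Longrightarrow> scale x A \<subseteq> A"
  by (rule image_subsetI) (rule ideal.I_l_closed)

definition colon :: "'a set \<Rightarrow> 'a \<Rightarrow> 'a set" where
  "colon A x = {r \<in> carrier R. x \<otimes> r \<in> A}"

lemma colon_ideal:
  assumes x: "x \<in> carrier R" and A: "ideal A R"
  shows "ideal (colon A x) R"
proof -
  interpret A: ideal A R by fact
  show ?thesis
    by (rule cring_idealI) (use x A.I_l_closed in \<open>auto simp: colon_def r_distr m_lcomm\<close>)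
qed

definition ideals_between :: "'a set \<Rightarrow> 'a set \<Rightarrow> 'a set set" where
  "ideals_between A B = {N. ideal N R \<and> A \<subseteq> N \<and> N \<subseteq> B}"

text \<open>The length of the module \<open>B/A\<close> for \<open>A \<subseteq> B\<close>: by the
  correspondence theorem its submodules are the ideals in between, so that length computations stay
  among ideals of \<open>R\<close>.\<close>

definition len :: "'a set \<Rightarrow> 'a set \<Rightarrow> enat" where
  "len A B = chain_height (ideals_between A B)"

lemma ideals_between_iff: "N \<in> ideals_between A B \<longleftrightarrow> ideal N R \<and> A \<subseteq> N \<and> N \<subseteq> B"
  by (simp add: ideals_between_def)

lemma len_mono: "A \<subseteq> A' \<Longrightarrow> B' \<subseteq> B \<Longrightarrow> len A' B' \<le> len A B"
  unfolding len_def ideals_between_def by (rule chain_height_mono) blast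

text \<open>If an element of \<open>D\<close> is a sum \<open>c + b\<close> with
  \<open>c \<in> C\<close> and \<open>b \<in> B\<close>, then \<open>b\<close> is in
  \<open>D \<inter> B = C \<inter> B\<close>, so the sum is in \<open>C\<close>. This is the modular
  law behind the additivity of length.\<close>

lemma modular_strict:
  assumes "ideal B R" "ideal C R" "ideal D R" "C \<subset> D" "C \<inter> B = D \<inter> B"
  shows "C <+> B \<noteq> D <+> B"
proof
  assume eq: "C <+> B = D <+> B"
  interpret D: ideal D R by fact
  interpret C: ideal C R by fact
  from assms(4) obtain d where d: "d \<in> D" "d \<notin> C" by auto
  have "d \<in> C <+> B" using eq d add_left_subset[OF assms(3,1)] by auto
  then obtain c b where cb: "c \<in> C" "b \<in> B" "d = c \<oplus> b" by (rule set_add_memE)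
  have "b \<in> D" using ideal_minusD[OF assms(3), of c b] cb d assms(4) ideal.Icarr[OF assms(1)] by auto
  hence "b \<in> C" using cb assms(5) by auto
  hence "d \<in> C" using cb by simp
  thus False using d by simp
qed

lemma set_add_mono: "A \<subseteq> B \<Longrightarrow> C \<subseteq> D \<Longrightarrow> A <+> C \<subseteq> B <+> D"
  unfolding set_add_def' by auto

text \<open>A chain from \<open>A\<close> to \<open>C\<close> yields one from \<open>A\<close> to
  \<open>B\<close> by intersecting with \<open>B\<close> and one from \<open>B\<close> to
  \<open>C\<close> by adding \<open>B\<close>; by \<open>modular_strict\<close> each step stays
  strict in at least one of them. Conversely, chains are concatenated at \<open>B\<close>. Comparing
  finite lower bounds covers infinite lengths as well.\<close>

lemma len_add:
  assumes "ideal A R" "ideal B R" "ideal C R" "A \<subseteq> B" "B \<subseteq> C"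
  shows "len A C = len A B + len B C"
proof -
  have ne: "ideals_between A B \<noteq> {}" "ideals_between B C \<noteq> {}" "ideals_between A C \<noteq> {}"
    using assms by (auto simp: ideals_between_def)
  show ?thesis
  proof (rule antisym; rule enat_leI_le)
    fix k assume "enat k \<le> len A C"
    then obtain U where U: "\<forall>i\<le>k. U i \<in> ideals_between A C" "\<forall>i<k. U i \<subset> U (Suc i)"
      unfolding len_def chain_height_ge_iff[OF ne(3)] by blast
    let ?S = "{i. i < k \<and> U i \<inter> B \<noteq> U (Suc i) \<inter> B}" and ?T = "{i. i < k \<and> U i <+> B \<noteq> U (Suc i) <+> B}"
    have 1: "enat (card ?S) \<le> len A B" unfolding len_def
      by (rule card_strict_steps_le_chain_height)
        (use U assms i_intersect in \<open>auto simp: ideals_between_iff\<close>)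
    have 2: "enat (card ?T) \<le> len B C" unfolding len_def
    proof (rule card_strict_steps_le_chain_height)
      fix i assume "i \<le> k"
      thus "U i <+> B \<in> ideals_between B C" using U assms
        by (simp add: ideals_between_iff add_ideals add_right_subset add_ideals_least)
    next
      fix i assume "i < k"
      thus "U i <+> B \<subseteq> U (Suc i) <+> B" using U by (intro set_add_mono) auto
    qed
    have "{..<k} \<subseteq> ?S \<union> ?T"
    proof
      fix i assume "i \<in> {..<k}"
      thus "i \<in> ?S \<union> ?T" using U modular_strict[OF assms(2), of "U i" "U (Suc i)"]
        by (auto simp: ideals_between_iff)
    qed
    hence "card {..<k} \<le> card (?S \<union> ?T)" by (intro card_mono) auto
    also have "\<dots> \<le> card ?S + card ?T" by (rule card_Un_le)
    finally have "enat k \<le> enat (card ?S) + enat (card ?T)" by simp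
    also have "\<dots> \<le> len A B + len B C" using 1 2 by (rule add_mono)
    finally show "enat k \<le> len A B + len B C" .
  next
    fix k assume "enat k \<le> len A B + len B C"
    then obtain i j where ij: "k = i + j" "enat i \<le> len A B" "enat j \<le> len B C"
      by (rule enat_le_add_split)
    then obtain U V where U: "\<forall>l\<le>i. U l \<in> ideals_between A B" "\<forall>l<i. U l \<subset> U (Suc l)"
      and V: "\<forall>l\<le>j. V l \<in> ideals_between B C" "\<forall>l<j. V l \<subset> V (Suc l)"
      unfolding len_def chain_height_ge_iff[OF ne(1)] chain_height_ge_iff[OF ne(2)] by blast
    \<comment> \<open>The member \<open>V 0\<close> is skipped, since it may equal
      \<open>U i\<close>; the step from \<open>U i\<close> to \<open>V 1\<close> is strict because
      \<open>U i \<subseteq> B \<subseteq> V 0 \<subset> V 1\<close>.\<close>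
    let ?W = "\<lambda>l. if l \<le> i then U l else V (l - i)"
    show "enat k \<le> len A C" unfolding len_def
    proof (rule le_chain_heightI[of k ?W])
      fix l assume "l \<le> k"
      show "?W l \<in> ideals_between A C"
      proof (cases "l \<le> i")
        case True
        hence "U l \<in> ideals_between A B" using U(1) by auto
        thus ?thesis using True assms by (auto simp: ideals_between_iff)
      next
        case False
        hence "V (l - i) \<in> ideals_between B C" using V(1) \<open>l \<le> k\<close> ij(1) by auto
        thus ?thesis using False assms by (auto simp: ideals_between_iff)
      qed
    next
      fix l assume l: "l < k"
      consider "l < i" | "l = i" | "l > i" by linarith
      thus "?W l \<subset> ?W (Suc l)"
      proof cases
        case 1 thus ?thesis using U by auto
      next
        case 2
        hence "U l \<subseteq> B" "B \<subseteq> V 0" "V 0 \<subset> V (Suc 0)" using U V l ij(1) by (auto simp: ideals_between_iff)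
        thus ?thesis using 2 by auto
      next
        case 3
        thus ?thesis using V(2)[rule_format, of "l - i"] l ij(1) by (auto simp: Suc_diff_le)
      qed
    qed
  qed
qed

text \<open>Multiplication by \<open>x\<close> maps \<open>B/A\<close> onto \<open>xB/xA\<close>;
  chains in the image are pulled back along this surjection by
  \<open>N \<mapsto> (N : x) \<inter> B\<close>.\<close>

lemma len_scale_le:
  assumes x: "x \<in> carrier R" and A: "ideal A R" and B: "ideal B R" and "A \<subseteq> B"
  shows "len (scale x A) (scale x B) \<le> len A B"
  unfolding len_def
proof (rule chain_height_le[of _ "\<lambda>N. colon N x \<inter> B"])
  fix N assume "N \<in> ideals_between (scale x A) (scale x B)"
  thus "colon N x \<inter> B \<in> ideals_between A B"
    using assms i_intersect colon_ideal ideal.Icarr[OF B] by (auto simp: ideals_between_iff colon_def)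
next
  fix N N' assume N: "N \<in> ideals_between (scale x A) (scale x B)" "N' \<in> ideals_between (scale x A) (scale x B)"
    and "N \<subset> N'"
  then obtain y where y: "y \<in> N'" "y \<notin> N" by auto
  then obtain b where "b \<in> B" "y = x \<otimes> b" using N by (auto simp: ideals_between_iff)
  hence "b \<in> colon N' x \<inter> B" "b \<notin> colon N x \<inter> B" using y ideal.Icarr[OF B] by (auto simp: colon_def)
  moreover have "colon N x \<inter> B \<subseteq> colon N' x \<inter> B" using \<open>N \<subset> N'\<close> by (auto simp: colon_def)
  ultimately show "colon N x \<inter> B \<subset> colon N' x \<inter> B" by blast
qed

text \<open>By the second isomorphism theorem \<open>A/(A \<inter> C)\<close> embeds into
  \<open>R/C\<close>. All the \<open>N\<close> involved meet \<open>C\<close> in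
  \<open>A \<inter> C\<close>, so \<open>modular_strict\<close> keeps the chain of the
  \<open>N + C\<close> strict.\<close>

lemma len_Int_le:
  assumes "ideal A R" "ideal C R"
  shows "len (A \<inter> C) A \<le> len C (carrier R)"
  unfolding len_def
proof (rule chain_height_le[of _ "\<lambda>N. N <+> C"])
  fix N assume "N \<in> ideals_between (A \<inter> C) A"
  thus "N <+> C \<in> ideals_between C (carrier R)"
    using assms add_ideals add_right_subset ideal.Icarr[OF add_ideals[of N C]] by (auto simp: ideals_between_iff)
next
  fix N N' assume N: "N \<in> ideals_between (A \<inter> C) A" "N' \<in> ideals_between (A \<inter> C) A" "N \<subset> N'"
  hence "N \<inter> C = N' \<inter> C" by (auto simp: ideals_between_iff)
  with modular_strict[OF assms(2), of N N'] N have "N <+> C \<noteq> N' <+> C" by (auto simp: ideals_between_iff)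
  thus "N <+> C \<subset> N' <+> C" using set_add_mono[of N N' C C] N by auto
qed

lemma len_eq_0D:
  assumes "ideal A R" "ideal B R" "A \<subseteq> B" "len A B = 0"
  shows "A = B"
proof (rule ccontr)
  assume "A \<noteq> B"
  hence "enat 1 \<le> len A B" unfolding len_def
    by (intro le_chain_heightI[of _ "\<lambda>i. if i = 0 then A else B"]) (use assms in \<open>auto simp: ideals_between_iff\<close>)
  thus False using assms(4) by (simp add: zero_enat_def)
qed

section \<open>Powers of ideals\<close>

definition ideal_power :: "'a set \<Rightarrow> nat \<Rightarrow> 'a set" (infixr \<open>^^^\<close> 85) where
  "A ^^^ n = A [^]\<^bsub>ideals_set R\<^esub> n"

lemma ideal_power_0 [simp]: "A ^^^ 0 = carrier R"
  by (simp add: ideal_power_def nat_pow_def ideals_set_def)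

lemma ideal_power_Suc: "A ^^^ Suc n = (A ^^^ n) \<cdot> A"
  by (simp add: ideal_power_def nat_pow_def ideals_set_def)

lemma ideal_power_ideal [simp]: "ideal A R \<Longrightarrow> ideal (A ^^^ n) R"
  unfolding ideal_power_def by (rule ideals_set_pow_ideal[OF is_cring])

lemma ideal_subset: "ideal A R \<Longrightarrow> A \<subseteq> carrier R"
  by (rule subsetI) (rule ideal.Icarr)

lemma ideal_power_carrier [simp]: "ideal A R \<Longrightarrow> a \<in> A ^^^ n \<Longrightarrow> a \<in> carrier R"
  using ideal.Icarr[OF ideal_power_ideal] .

lemma ideal_power_add:
  assumes "ideal A R"
  shows "A ^^^ (m + n) = (A ^^^ m) \<cdot> (A ^^^ n)"
proof -
  interpret S: comm_monoid "ideals_set R" by (rule ideals_set_is_comm_monoid)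
  have "A \<in> carrier (ideals_set R)" using assms by (simp add: ideals_set_def)
  from S.nat_pow_mult[OF this, of m n] show ?thesis by (simp add: ideals_set_def ideal_power_def)
qed

lemma ideal_power_mult_mem:
  "ideal A R \<Longrightarrow> a \<in> A ^^^ m \<Longrightarrow> b \<in> A ^^^ n \<Longrightarrow> a \<otimes> b \<in> A ^^^ (m + n)"
  by (simp add: ideal_power_add ideal_prod.prod)

lemma ideal_power_1: "ideal A R \<Longrightarrow> A ^^^ (Suc 0) = A"
  using ideal_prod_commute[OF oneideal, of A] ideal_prod_one[of A] by (simp add: ideal_power_Suc)

lemma ideal_power_antimono: "ideal A R \<Longrightarrow> k \<le> l \<Longrightarrow> A ^^^ l \<subseteq> A ^^^ k"
  unfolding ideal_power_def by (rule ideals_set_pow_antimono[OF is_cring])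

lemma pow_mem_ideal_power:
  assumes "ideal A R" "a \<in> A ^^^ d"
  shows "a [^] (n::nat) \<in> A ^^^ (n * d)"
proof (induction n)
  case (Suc n)
  from ideal_power_mult_mem[OF assms(1) this assms(2)] show ?case by (simp add: add.commute)
qed auto

lemma ideal_power_mono:
  assumes "ideal A R" "ideal B R" "A \<subseteq> B"
  shows "A ^^^ n \<subseteq> B ^^^ n"
proof (induction n)
  case (Suc n)
  show ?case unfolding ideal_power_Suc[of A]
  proof (rule ideal_prod_least)
    fix a b assume "a \<in> A ^^^ n" "b \<in> A"
    thus "a \<otimes> b \<in> B ^^^ Suc n" unfolding ideal_power_Suc using Suc assms(3) by (auto intro: ideal_prod.prod)
  qed (use assms in simp)
qed simp

lemma ideal_add_mem: "ideal A R \<Longrightarrow> a \<in> A \<Longrightarrow> b \<in> A \<Longrightarrow> a \<oplus> b \<in> A"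
  by (rule additive_subgroup.a_closed[OF ideal.axioms(1)])

lemma ideal_zero_mem: "ideal A R \<Longrightarrow> \<zero> \<in> A"
  by (rule additive_subgroup.zero_closed[OF ideal.axioms(1)])

lemma ideal_minus_mem: "ideal A R \<Longrightarrow> a \<in> A \<Longrightarrow> b \<in> A \<Longrightarrow> a \<ominus> b \<in> A"
  unfolding a_minus_def by (intro ideal_add_mem additive_subgroup.a_inv_closed[OF ideal.axioms(1)])

lemma add_minus_cancel_mem:
  assumes "ideal A R" "a \<ominus> b \<in> A" "b \<in> A" "a \<in> carrier R"
  shows "a \<in> A"
proof -
  have "b \<in> carrier R" using ideal.Icarr[OF assms(1,3)] .
  hence "a = (a \<ominus> b) \<oplus> b" using assms(4) by algebra
  thus ?thesis using ideal_add_mem[OF assms(1,2,3)] by simp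
qed

lemma principal_ideal: "x \<in> carrier R \<Longrightarrow> ideal (scale x (carrier R)) R"
  by (rule scale_ideal[OF _ oneideal])

lemma principal_self: "x \<in> carrier R \<Longrightarrow> x \<in> scale x (carrier R)"
  by (rule image_eqI[of _ _ \<one>]) auto

lemma principal_least: "ideal A R \<Longrightarrow> x \<in> A \<Longrightarrow> scale x (carrier R) \<subseteq> A"
  by (rule image_subsetI) (rule ideal.I_r_closed)

lemma principal_power:
  assumes "x \<in> carrier R"
  shows "(scale x (carrier R)) ^^^ n \<subseteq> scale (x [^] n) (carrier R)"
proof (induction n)
  case (Suc n)
  show ?case unfolding ideal_power_Suc
  proof (rule ideal_prod_least)
    fix a b assume "a \<in> (scale x (carrier R)) ^^^ n" "b \<in> scale x (carrier R)"
    then obtain r s where "r \<in> carrier R" "s \<in> carrier R" "a = x [^] n \<otimes> r" "b = x \<otimes> s" using Suc by auto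
    thus "a \<otimes> b \<in> scale (x [^] Suc n) (carrier R)"
      using assms by (intro image_eqI[of _ _ "r \<otimes> s"]) (auto simp: m_ac)
  qed (use assms in \<open>simp add: principal_ideal\<close>)
next
  case 0
  show ?case using image_eqI[of _ "(\<otimes>) \<one>" _ "carrier R"] by auto
qed

lemma subset_add_principal:
  assumes "ideal A R" "x \<in> carrier R"
  shows "ideal (A <+> scale x (carrier R)) R" "A \<subseteq> A <+> scale x (carrier R)" "x \<in> A <+> scale x (carrier R)"
  using add_left_subset[of A "scale x (carrier R)"] add_right_subset[of A "scale x (carrier R)"]
    add_ideals[of A "scale x (carrier R)"] principal_ideal principal_self assms by auto

lemma len_self: "len A A = 0"
proof -
  have "len A A \<le> enat 0" unfolding len_def
  proof (rule chain_height_leI)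
    fix n and C :: "nat \<Rightarrow> 'a set"
    assume C: "\<And>i. i \<le> n \<Longrightarrow> C i \<in> ideals_between A A" "\<And>i. i < n \<Longrightarrow> C i \<subset> C (Suc i)"
    have "n = 0"
    proof (rule ccontr)
      assume "n \<noteq> 0"
      hence "C 0 = A" "C 1 = A" using C(1)[of 0] C(1)[of 1] by (auto simp: ideals_between_iff)
      thus False using C(2)[of 0] \<open>n \<noteq> 0\<close> by auto
    qed
    thus "enat n \<le> enat 0" by simp
  qed
  thus ?thesis unfolding zero_enat_def[symmetric] by simp
qed

end

section \<open>Noetherian rings\<close>

locale noetherian_cring = cring + noetherian_ring
begin

text \<open>In a Noetherian ring a nonempty chain of ideals contains its own union, so Zorn's lemma
  applies to an arbitrary family \<open>F\<close>.\<close>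

lemma exists_maximal_ideal_in:
  assumes "F \<noteq> {}" "\<And>A. A \<in> F \<Longrightarrow> ideal A R"
  obtains M where "M \<in> F" "\<And>A. A \<in> F \<Longrightarrow> M \<subseteq> A \<Longrightarrow> A = M"
proof -
  have "\<exists>M\<in>F. \<forall>A\<in>F. M \<subseteq> A \<longrightarrow> A = M"
  proof (rule subset_Zorn_nonempty[OF assms(1)])
    fix C assume C: "C \<noteq> {}" "subset.chain F C"
    have "subset.chain {I. ideal I R} C" using C(2) assms(2) unfolding pred_on.chain_def by auto
    from ideal_chain_is_trivial[OF C(1) this] show "\<Union>C \<in> F" using C(2) unfolding pred_on.chain_def by auto
  qed
  thus thesis using that by blast
qed

lemma ideal_noetherian_induct [consumes 1, case_names less]:
  assumes "ideal A R"
    and "\<And>A. ideal A R \<Longrightarrow> (\<And>B. ideal B R \<Longrightarrow> A \<subset> B \<Longrightarrow> P B) \<Longrightarrow> P A"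
  shows "P A"
proof (rule ccontr)
  assume "\<not> P A"
  hence "{A. ideal A R \<and> \<not> P A} \<noteq> {}" using assms(1) by auto
  then obtain M where M: "M \<in> {A. ideal A R \<and> \<not> P A}" "\<And>A. A \<in> {A. ideal A R \<and> \<not> P A} \<Longrightarrow> M \<subseteq> A \<Longrightarrow> A = M"
    by (rule exists_maximal_ideal_in) auto
  have "P M"
  proof (rule assms(2))
    show "ideal M R" using M(1) by simp
    fix B assume "ideal B R" "M \<subset> B"
    thus "P B" using M(2)[of B] by blast
  qed
  thus False using M(1) by simp
qed

text \<open>If every element of \<open>I\<close> is nilpotent modulo the graded family \<open>W\<close>, then so is \<open>I\<close> itself:
  the ideals \<open>A \<subseteq> I\<close> with \<open>A\<^sup>p \<subseteq> W p\<close> for some \<open>p\<close> are closed under sums, by the binomial expansion of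
  \<open>(A + B)\<^sup>p\<^sup>+\<^sup>q\<close>.\<close>

lemma ideal_power_subset_if_pow_mem:
  assumes I: "ideal I R" and W: "\<And>n. ideal (W n) R"
    and step: "\<And>n a b. a \<in> W n \<Longrightarrow> b \<in> I \<Longrightarrow> a \<otimes> b \<in> W (Suc n)"
    and nil: "\<And>a. a \<in> I \<Longrightarrow> \<exists>p::nat. a [^] p \<in> W p"
  shows "\<exists>p. I ^^^ p \<subseteq> W p"
proof -
  have Wc: "a \<in> carrier R" if "a \<in> W n" for a n using ideal.Icarr[OF W that] .
  have step': "a \<otimes> b \<in> W (n + k)" if "a \<in> W n" "b \<in> I ^^^ k" for a b n k
    using that(2)
  proof (induction k arbitrary: b)
    case 0
    thus ?case using ideal.I_r_closed[OF W that(1)] by simp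
  next
    case (Suc k)
    have "I ^^^ Suc k \<subseteq> colon (W (n + Suc k)) a" unfolding ideal_power_Suc
    proof (rule ideal_prod_least)
      show "ideal (colon (W (n + Suc k)) a) R" using colon_ideal[OF Wc[OF that(1)] W] .
      fix c d assume cd: "c \<in> I ^^^ k" "d \<in> I"
      have "(a \<otimes> c) \<otimes> d \<in> W (n + Suc k)" using step[OF Suc.IH[OF cd(1)] cd(2)] by simp
      thus "c \<otimes> d \<in> colon (W (n + Suc k)) a" unfolding colon_def
        using Wc[OF that(1)] I cd ideal.Icarr[OF I cd(2)] by (simp add: m_assoc)
    qed
    thus ?case using Suc.prems by (auto simp: colon_def)
  qed
  have join: "(A <+> B) ^^^ (p + q) \<subseteq> W (p + q)"
    if A: "ideal A R" "A \<subseteq> I" "A ^^^ p \<subseteq> W p" and B: "ideal B R" "B \<subseteq> I" "B ^^^ q \<subseteq> W q" for A B p q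
  proof -
    have up: "C ^^^ i \<subseteq> W i" if C: "ideal C R" "C \<subseteq> I" "C ^^^ r \<subseteq> W r" "r \<le> i" for C r i
    proof -
      have "(C ^^^ r) \<cdot> (C ^^^ (i - r)) \<subseteq> W i"
        using C step'[of _ r _ "i - r"] ideal_power_mono[OF C(1) I C(2)]
        by (intro ideal_prod_least[OF W]) (auto simp: subset_iff)
      thus ?thesis using ideal_power_add[OF C(1), of r "i - r"] C(4) by simp
    qed
    have AB: "ideal (A <+> B) R" using A B by (simp add: add_ideals)
    have uvI: "u \<otimes> v \<in> W (i + j)" if "u \<in> A ^^^ i" "v \<in> B ^^^ j" "i + j = p + q" for u v i j
    proof (cases "p \<le> i")
      case True
      thus ?thesis using up[OF A True] step'[of u i v j] that ideal_power_mono[OF B(1) I B(2)] by auto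
    next
      case False
      hence "q \<le> j" using that(3) by simp
      hence "v \<otimes> u \<in> W (j + i)" using up[OF B] step'[of v j u i] that ideal_power_mono[OF A(1) I A(2)] by auto
      thus ?thesis using that A B by (simp add: m_comm add.commute)
    qed
    \<comment> \<open>The power is expanded one factor at a time: \<open>u\<close> and
      \<open>v\<close> collect the \<open>i\<close> factors already taken from \<open>A\<close> and
      the \<open>j\<close> factors taken from \<open>B\<close>. When no factor is left,
      \<open>i + j = p + q\<close> forces \<open>p \<le> i\<close> or
      \<open>q \<le> j\<close>.\<close>
    have "(A <+> B) ^^^ k \<subseteq> colon (W (p + q)) (u \<otimes> v)"
      if "u \<in> A ^^^ i" "v \<in> B ^^^ j" "i + j + k = p + q" for k i j u v
      using that
    proof (induction k arbitrary: i j u v)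
      case 0
      thus ?case using uvI[of u i v j] ideal.I_r_closed[OF W] by (auto simp: colon_def)
    next
      case (Suc k)
      have uv: "u \<in> carrier R" "v \<in> carrier R" using Suc.prems A B by auto
      show ?case unfolding ideal_power_Suc
      proof (rule ideal_prod_least)
        show "ideal (colon (W (p + q)) (u \<otimes> v)) R" using colon_ideal[OF _ W] uv by simp
        fix w c assume w: "w \<in> (A <+> B) ^^^ k" and c: "c \<in> A <+> B"
        then obtain a b where ab: "a \<in> A" "b \<in> B" "c = a \<oplus> b" by (auto elim: set_add_memE)
        have car: "w \<in> carrier R" "a \<in> carrier R" "b \<in> carrier R"
          using w AB ideal.Icarr[OF A(1)] ideal.Icarr[OF B(1)] ab by auto
        have "u \<otimes> a \<in> A ^^^ (Suc i)" "v \<otimes> b \<in> B ^^^ Suc j"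
          unfolding ideal_power_Suc using Suc.prems ab by (auto intro: ideal_prod.prod)
        hence "w \<in> colon (W (p + q)) ((u \<otimes> a) \<otimes> v)" "w \<in> colon (W (p + q)) (u \<otimes> (v \<otimes> b))"
          using Suc.IH[of "u \<otimes> a" "Suc i" v j] Suc.IH[of u i "v \<otimes> b" "Suc j"] Suc.prems w by auto
        hence "((u \<otimes> a) \<otimes> v) \<otimes> w \<oplus> (u \<otimes> (v \<otimes> b)) \<otimes> w \<in> W (p + q)"
          using ideal_add_mem[OF W] by (auto simp: colon_def)
        also have "((u \<otimes> a) \<otimes> v) \<otimes> w \<oplus> (u \<otimes> (v \<otimes> b)) \<otimes> w = (u \<otimes> v) \<otimes> (w \<otimes> c)"
          unfolding ab(3) using uv car by algebra
        finally show "w \<otimes> c \<in> colon (W (p + q)) (u \<otimes> v)" using car ab(3) by (simp add: colon_def)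
      qed
    qed
    from this[of \<one> 0 \<one> 0 "p + q"] show ?thesis
      using ideal_power_carrier[OF AB] by (auto simp: colon_def)
  qed
  \<comment> \<open>A maximal member of \<open>?S\<close> absorbs the principal ideal of every
    element of \<open>I\<close>, hence equals \<open>I\<close>. This stands in for an induction over
    generators.\<close>
  let ?S = "{A. ideal A R \<and> A \<subseteq> I \<and> (\<exists>p. A ^^^ p \<subseteq> W p)}"
  have "{\<zero>} ^^^ 1 \<subseteq> W 1" using ideal_zero_mem[OF W] zeroideal by (simp add: ideal_power_1)
  hence "{\<zero>} \<in> ?S" using zeroideal ideal_zero_mem[OF I] by blast
  hence "?S \<noteq> {}" by blast
  then obtain A where A: "A \<in> ?S" "\<And>B. B \<in> ?S \<Longrightarrow> A \<subseteq> B \<Longrightarrow> B = A" by (rule exists_maximal_ideal_in) auto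
  then obtain p where p: "A ^^^ p \<subseteq> W p" and A': "ideal A R" "A \<subseteq> I" by auto
  have "I \<subseteq> A"
  proof
    fix a assume a: "a \<in> I"
    hence ac: "a \<in> carrier R" using ideal.Icarr[OF I] by simp
    let ?B = "scale a (carrier R)"
    obtain q :: nat where q: "a [^] q \<in> W q" using nil[OF a] by blast
    have B: "ideal ?B R" "?B \<subseteq> I" "?B ^^^ q \<subseteq> W q"
      using principal_ideal[OF ac] principal_least[OF I a] principal_power[OF ac, of q] principal_least[OF W q]
      by auto
    have "A <+> ?B \<in> ?S" using join[OF A' p B] add_ideals[OF A'(1) B(1)] add_ideals_least[OF I A'(2) B(2)] by blast
    hence "A <+> ?B = A" using A(2) add_left_subset[OF A'(1) B(1)] by blast
    thus "a \<in> A" using subset_add_principal(3)[OF A'(1) ac] by simp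
  qed
  hence "A = I" using A' by blast
  thus ?thesis using p by blast
qed

section \<open>Prime ideals and radicals\<close>

lemma prime_step:
  assumes A: "ideal A R" and "\<not> primeideal A R" and "A \<noteq> carrier R"
  obtains a b where "a \<in> carrier R" "b \<in> carrier R" "a \<notin> A" "b \<notin> A" "a \<otimes> b \<in> A"
proof -
  have "\<exists>a\<in>carrier R. \<exists>b\<in>carrier R. a \<otimes> b \<in> A \<and> a \<notin> A \<and> b \<notin> A"
  proof (rule ccontr)
    assume c: "\<not> ?thesis"
    have "primeideal A R" by (rule primeidealI[OF A is_cring]) (use assms(3) c in auto)
    thus False using assms(2) by simp
  qed
  thus thesis using that by auto
qed

lemma add_principal_strict:
  assumes "ideal A R" "x \<in> carrier R" "x \<notin> A"
  shows "A \<subset> A <+> scale x (carrier R)"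
  using subset_add_principal[OF assms(1,2)] assms(3) by blast

text \<open>Noetherian induction: if \<open>a b \<in> A\<close> with \<open>a\<close> and
  \<open>b\<close> outside \<open>A\<close>, then powers of \<open>f\<close> lie in
  \<open>A + aR\<close> and in \<open>A + bR\<close>, and the product of these two ideals lies in
  \<open>A\<close>. This is the description of the radical as an intersection of primes.\<close>

lemma pow_mem_if_mem_primes:
  assumes "ideal A R" "f \<in> carrier R" "\<And>P. primeideal P R \<Longrightarrow> A \<subseteq> P \<Longrightarrow> f \<in> P"
  shows "\<exists>k::nat. f [^] k \<in> A"
  using assms(1,3)
proof (induction A rule: ideal_noetherian_induct)
  case (less A)
  show ?case
  proof (cases "primeideal A R \<or> A = carrier R")
    case True
    thus ?thesis
    proof
      assume "primeideal A R"
      hence "f [^] (Suc 0) \<in> A" using less(3)[of A] assms(2) by simp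
      thus ?thesis by blast
    qed (use assms(2) in simp)
  next
    case False
    then obtain a b where ab: "a \<in> carrier R" "b \<in> carrier R" "a \<notin> A" "b \<notin> A" "a \<otimes> b \<in> A"
      using prime_step[OF less(1)] by blast
    have IH: "\<exists>k::nat. f [^] k \<in> A <+> scale x (carrier R)" if "x \<in> carrier R" "x \<notin> A" for x
      using less(2)[OF subset_add_principal(1)[OF less(1) that(1)] add_principal_strict[OF less(1) that]]
        less(3) add_principal_strict[OF less(1) that] by auto
    obtain i c r where 1: "c \<in> A" "r \<in> carrier R" "f [^] (i::nat) = c \<oplus> a \<otimes> r"
      using IH[OF ab(1,3)] by (auto elim!: set_add_memE)
    obtain j d s where 2: "d \<in> A" "s \<in> carrier R" "f [^] (j::nat) = d \<oplus> b \<otimes> s"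
      using IH[OF ab(2,4)] by (auto elim!: set_add_memE)
    have cd: "c \<in> carrier R" "d \<in> carrier R" using ideal.Icarr[OF less(1)] 1 2 by auto
    have "f [^] (i + j) = (c \<oplus> a \<otimes> r) \<otimes> (d \<oplus> b \<otimes> s)" using 1(3) 2(3) assms(2) by (simp flip: nat_pow_mult)
    also have "\<dots> = c \<otimes> (d \<oplus> b \<otimes> s) \<oplus> (d \<otimes> (a \<otimes> r) \<oplus> (a \<otimes> b) \<otimes> (r \<otimes> s))"
      using ab 1(2) 2(2) cd by algebra
    also have "\<dots> \<in> A"
    proof (intro ideal_add_mem[OF less(1)])
      show "c \<otimes> (d \<oplus> b \<otimes> s) \<in> A" using 1 2 ab cd by (intro ideal.I_r_closed[OF less(1) 1(1)]) auto
      show "d \<otimes> (a \<otimes> r) \<in> A" using 1 2 ab cd by (intro ideal.I_r_closed[OF less(1) 2(1)]) auto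
      show "(a \<otimes> b) \<otimes> (r \<otimes> s) \<in> A" using 1 2 ab cd by (intro ideal.I_r_closed[OF less(1) ab(5)]) auto
    qed
    finally show ?thesis by blast
  qed
qed

text \<open>The same induction: a prime over \<open>A\<close> contains \<open>a\<close> or
  \<open>b\<close> when \<open>a b \<in> A\<close>, so the sets found for \<open>A + aR\<close> and
  \<open>A + bR\<close> together serve \<open>A\<close>. The set \<open>Ps\<close> may contain more
  than the minimal primes; what counts is that it is finite and that every prime over
  \<open>A\<close> lies above a member.\<close>

lemma finite_minimal_primes:
  assumes "ideal A R"
  shows "\<exists>Ps. finite Ps \<and> (\<forall>P\<in>Ps. primeideal P R) \<and> (\<forall>Q. primeideal Q R \<longrightarrow> A \<subseteq> Q \<longrightarrow> (\<exists>P\<in>Ps. P \<subseteq> Q))"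
  using assms
proof (induction A rule: ideal_noetherian_induct)
  case (less A)
  show ?case
  proof (cases "primeideal A R \<or> A = carrier R")
    case True
    thus ?thesis
    proof
      assume "primeideal A R"
      thus ?thesis by (intro exI[of _ "{A}"]) auto
    next
      assume "A = carrier R"
      hence "\<not> (primeideal Q R \<and> A \<subseteq> Q)" for Q
        using ideal_subset[OF primeideal.axioms(1), of Q] primeideal.I_notcarr[of Q] by auto
      thus ?thesis by (intro exI[of _ "{}"]) auto
    qed
  next
    case False
    then obtain a b where ab: "a \<in> carrier R" "b \<in> carrier R" "a \<notin> A" "b \<notin> A" "a \<otimes> b \<in> A"
      using prime_step[OF less(1)] by blast
    obtain P1 where P1: "finite P1" "\<forall>P\<in>P1. primeideal P R"
      "\<And>Q. primeideal Q R \<Longrightarrow> A <+> scale a (carrier R) \<subseteq> Q \<Longrightarrow> \<exists>P\<in>P1. P \<subseteq> Q"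
      using less(2)[OF subset_add_principal(1)[OF less(1) ab(1)] add_principal_strict[OF less(1) ab(1,3)]] by blast
    obtain P2 where P2: "finite P2" "\<forall>P\<in>P2. primeideal P R"
      "\<And>Q. primeideal Q R \<Longrightarrow> A <+> scale b (carrier R) \<subseteq> Q \<Longrightarrow> \<exists>P\<in>P2. P \<subseteq> Q"
      using less(2)[OF subset_add_principal(1)[OF less(1) ab(2)] add_principal_strict[OF less(1) ab(2,4)]] by blast
    have "\<exists>P\<in>P1 \<union> P2. P \<subseteq> Q" if Q: "primeideal Q R" "A \<subseteq> Q" for Q
    proof -
      have iQ: "ideal Q R" using primeideal.axioms(1)[OF Q(1)] .
      have "a \<in> Q \<or> b \<in> Q" using primeideal.I_prime[OF Q(1) ab(1,2)] Q(2) ab(5) by auto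
      thus ?thesis
      proof
        assume "a \<in> Q"
        hence "A <+> scale a (carrier R) \<subseteq> Q" by (intro add_ideals_least iQ Q(2) principal_least)
        thus ?thesis using P1(3)[OF Q(1)] by blast
      next
        assume "b \<in> Q"
        hence "A <+> scale b (carrier R) \<subseteq> Q" by (intro add_ideals_least iQ Q(2) principal_least)
        thus ?thesis using P2(3)[OF Q(1)] by blast
      qed
    qed
    thus ?thesis using P1(1,2) P2(1,2) by (intro exI[of _ "P1 \<union> P2"]) auto
  qed
qed

end

section \<open>Noetherian local rings\<close>

locale noetherian_local_ring = noetherian_cring R + local_ring R \<mm> for R (structure) and \<mm>
begin

lemma max_ideal: "ideal \<mm> R"
  by (rule ideal_axioms)

lemma one_notin_max: "\<one> \<notin> \<mm>"
  using one_imp_carrier I_notcarr by auto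

lemma proper_ideal_subset_max:
  assumes "ideal A R" "A \<noteq> carrier R"
  shows "A \<subseteq> \<mm>"
proof -
  let ?F = "{B. ideal B R \<and> A \<subseteq> B \<and> B \<noteq> carrier R}"
  have "?F \<noteq> {}" using assms by auto
  then obtain M where M: "M \<in> ?F" "\<And>B. B \<in> ?F \<Longrightarrow> M \<subseteq> B \<Longrightarrow> B = M" by (rule exists_maximal_ideal_in) auto
  have "maximalideal M R"
  proof (rule maximalidealI)
    fix J assume "ideal J R" "M \<subseteq> J" "J \<subseteq> carrier R"
    thus "J = M \<or> J = carrier R" using M by blast
  qed (use M in auto)
  hence "M = \<mm>" by (rule maximalideal_unique)
  thus ?thesis using M(1) by auto
qed

lemma unit_if_notin_max:
  assumes "a \<in> carrier R" "a \<notin> \<mm>"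
  obtains b where "b \<in> carrier R" "b \<otimes> a = \<one>"
proof -
  have "scale a (carrier R) = carrier R"
    using proper_ideal_subset_max[OF principal_ideal[OF assms(1)]] principal_self[OF assms(1)] assms(2) by blast
  then obtain b where "b \<in> carrier R" "\<one> = a \<otimes> b" using one_closed by (metis imageE)
  thus thesis using that[of b] assms(1) by (simp add: m_comm)
qed

text \<open>Nakayama's lemma.  A maximal ideal \<open>C\<close> with \<open>N' \<subseteq> C \<subset> N\<close> would satisfy \<open>N = C + yR\<close> and
  \<open>y \<in> C + y\<mm>\<close>, so that \<open>y \<in> C\<close>.\<close>

lemma nakayama:
  assumes N: "ideal N R" and N': "ideal N' R" and "N' \<subseteq> N" and sub: "N \<subseteq> N' <+> \<mm> \<cdot> N"
  shows "N = N'"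
proof (rule ccontr)
  assume "N \<noteq> N'"
  let ?F = "{C. ideal C R \<and> N' \<subseteq> C \<and> C \<subset> N}"
  have "?F \<noteq> {}" using N' \<open>N \<noteq> N'\<close> \<open>N' \<subseteq> N\<close> by auto
  then obtain C where C: "C \<in> ?F" "\<And>B. B \<in> ?F \<Longrightarrow> C \<subseteq> B \<Longrightarrow> B = C" by (rule exists_maximal_ideal_in) auto
  hence iC: "ideal C R" "N' \<subseteq> C" "C \<subseteq> N" by auto
  from C obtain y where y: "y \<in> N" "y \<notin> C" by auto
  have yc: "y \<in> carrier R" using ideal.Icarr[OF N y(1)] .
  have "C <+> scale y (carrier R) \<subseteq> N"
    by (intro add_ideals_least N iC principal_least y)
  hence "C <+> scale y (carrier R) = N"
    using C(2)[of "C <+> scale y (carrier R)"] add_principal_strict[OF iC(1) yc y(2)]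
      subset_add_principal(1)[OF iC(1) yc] iC(2) by blast
  note N_eq = this[symmetric]
  have iD: "ideal (C <+> scale y \<mm>) R" by (intro add_ideals iC scale_ideal yc max_ideal)
  have "\<mm> \<cdot> N \<subseteq> C <+> scale y \<mm>"
  proof (rule ideal_prod_least[OF iD])
    fix t n assume t: "t \<in> \<mm>" and "n \<in> N"
    then obtain c r where cr: "c \<in> C" "r \<in> carrier R" "n = c \<oplus> y \<otimes> r"
      unfolding N_eq by (auto elim!: set_add_memE)
    have "t \<otimes> n = t \<otimes> c \<oplus> y \<otimes> (t \<otimes> r)"
      using cr(2) yc Icarr[OF t] ideal.Icarr[OF iC(1) cr(1)] unfolding cr(3) by algebra
    moreover have "t \<otimes> c \<in> C" using ideal.I_l_closed[OF iC(1) cr(1)] Icarr[OF t] by simp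
    moreover have "t \<otimes> r \<in> \<mm>" using I_r_closed[OF t cr(2)] .
    ultimately show "t \<otimes> n \<in> C <+> scale y \<mm>" by (auto intro: set_add_memI)
  qed
  moreover have "N' \<subseteq> C <+> scale y \<mm>"
    using add_left_subset[OF iC(1) scale_ideal[OF yc max_ideal]] iC(2) by blast
  ultimately have "N \<subseteq> C <+> scale y \<mm>" using sub add_ideals_least[OF iD] by blast
  then obtain c t where ct: "c \<in> C" "t \<in> \<mm>" "y = c \<oplus> y \<otimes> t" using y(1) by (auto elim!: set_add_memE)
  have tc: "t \<in> carrier R" "c \<in> carrier R" using Icarr[OF ct(2)] ideal.Icarr[OF iC(1) ct(1)] by auto
  \<comment> \<open>From \<open>y = c + y t\<close> follows \<open>(1 - t) y = c\<close>, and
    \<open>1 - t\<close> is a unit because \<open>t \<in> \<mm>\<close>.\<close>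
  have "\<one> \<ominus> t \<notin> \<mm>"
  proof
    assume "\<one> \<ominus> t \<in> \<mm>"
    hence "(\<one> \<ominus> t) \<oplus> t \<in> \<mm>" using ct(2) by (intro ideal_add_mem max_ideal)
    moreover have "(\<one> \<ominus> t) \<oplus> t = \<one>" using tc by algebra
    ultimately show False using one_notin_max by simp
  qed
  then obtain s where s: "s \<in> carrier R" "s \<otimes> (\<one> \<ominus> t) = \<one>"
    using unit_if_notin_max[of "\<one> \<ominus> t"] tc by auto
  have "y = (s \<otimes> (\<one> \<ominus> t)) \<otimes> y" using s yc by simp
  also have "\<dots> = s \<otimes> (y \<ominus> y \<otimes> t)" using s(1) tc yc by algebra
  also have "y \<ominus> y \<otimes> t = (c \<oplus> y \<otimes> t) \<ominus> y \<otimes> t" using ct(3) by simp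
  also have "\<dots> = c" using tc yc by algebra
  finally show False using y(2) ideal.I_l_closed[OF iC(1) ct(1) s(1)] by simp
qed

section \<open>Saturation \<open>A : \<mm>^\<infinity>\<close> and finite length\<close>

definition sat :: "'a set \<Rightarrow> 'a set" where
  "sat A = {f \<in> carrier R. \<exists>k. \<forall>a\<in>\<mm> ^^^ k. a \<otimes> f \<in> A}"

lemma sat_ideal:
  assumes A: "ideal A R"
  shows "ideal (sat A) R"
proof (rule cring_idealI)
  show "\<zero> \<in> sat A" using ideal_zero_mem[OF A] max_ideal unfolding sat_def by auto
  fix f g assume "f \<in> sat A" "g \<in> sat A"
  then obtain k l where k: "\<forall>a\<in>\<mm> ^^^ k. a \<otimes> f \<in> A" and l: "\<forall>a\<in>\<mm> ^^^ l. a \<otimes> g \<in> A"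
    and c: "f \<in> carrier R" "g \<in> carrier R" by (auto simp: sat_def)
  have "a \<otimes> (f \<oplus> g) \<in> A" if a: "a \<in> \<mm> ^^^ (k + l)" for a
  proof -
    have "a \<in> \<mm> ^^^ k" "a \<in> \<mm> ^^^ l"
      using a ideal_power_antimono[OF max_ideal, of k "k + l"] ideal_power_antimono[OF max_ideal, of l "k + l"] by auto
    thus ?thesis using k l c ideal_add_mem[OF A] max_ideal by (simp add: r_distr)
  qed
  thus "f \<oplus> g \<in> sat A" using c unfolding sat_def by blast
next
  fix f r assume "f \<in> sat A" and r: "r \<in> carrier R"
  then obtain k where k: "\<forall>a\<in>\<mm> ^^^ k. a \<otimes> f \<in> A" and c: "f \<in> carrier R" by (auto simp: sat_def)
  have "a \<otimes> (r \<otimes> f) \<in> A" if a: "a \<in> \<mm> ^^^ k" for a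
  proof -
    have "a \<otimes> (r \<otimes> f) = r \<otimes> (a \<otimes> f)" using a c r max_ideal by (simp add: m_lcomm)
    thus ?thesis using k a ideal.I_l_closed[OF A _ r] by simp
  qed
  thus "r \<otimes> f \<in> sat A" using c r unfolding sat_def by auto
qed (auto simp: sat_def)

lemma subset_sat: "ideal A R \<Longrightarrow> A \<subseteq> sat A"
  using ideal.Icarr ideal.I_l_closed unfolding sat_def by (auto intro!: exI[of _ 0])

lemma sat_mono: "A \<subseteq> B \<Longrightarrow> sat A \<subseteq> sat B"
  unfolding sat_def by blast

lemma subset_sat_if_power:
  assumes "B \<subseteq> carrier R" "\<And>a b. a \<in> \<mm> ^^^ k \<Longrightarrow> b \<in> B \<Longrightarrow> a \<otimes> b \<in> A"
  shows "B \<subseteq> sat A"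
  using assms unfolding sat_def by blast

text \<open>Since \<open>y \<mm> \<subseteq> C\<close>, the module \<open>(C + yR)/C\<close> is a
  quotient of the residue field. Concretely, an ideal properly above \<open>C\<close> inside
  \<open>C + yR\<close> contains some \<open>c + y r\<close> with \<open>r\<close> a unit, hence
  \<open>y\<close>.\<close>

lemma len_add_principal_le:
  assumes C: "ideal C R" and y: "y \<in> carrier R" and ann: "\<And>t. t \<in> \<mm> \<Longrightarrow> y \<otimes> t \<in> C"
  shows "len C (C <+> scale y (carrier R)) \<le> enat 1"
  unfolding len_def
proof (rule chain_height_leI)
  fix n and D :: "nat \<Rightarrow> 'a set"
  assume D: "\<And>i. i \<le> n \<Longrightarrow> D i \<in> ideals_between C (C <+> scale y (carrier R))"
    "\<And>i. i < n \<Longrightarrow> D i \<subset> D (Suc i)"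
  have "n \<le> 1"
  proof (rule ccontr)
    assume "\<not> n \<le> 1"
    hence n: "0 < n" "1 < n" "0 \<le> n" "1 \<le> n" "2 \<le> n" by auto
    have i1: "ideal (D 1) R" "C \<subseteq> D 1" using D(1)[OF n(4)] by (auto simp: ideals_between_iff)
    have "C \<subseteq> D 0" "D 0 \<subset> D 1" "D 1 \<subseteq> C <+> scale y (carrier R)"
      using D(1)[OF n(3)] D(1)[OF n(4)] D(2)[OF n(1)] by (simp_all add: ideals_between_iff)
    then obtain w where w: "w \<in> D 1" "w \<notin> C" "w \<in> C <+> scale y (carrier R)" by blast
    then obtain c r where cr: "c \<in> C" "r \<in> carrier R" "w = c \<oplus> y \<otimes> r" by (auto elim!: set_add_memE)
    have "r \<notin> \<mm>" using ann[of r] w(2) cr ideal_add_mem[OF C] by auto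
    then obtain s where s: "s \<in> carrier R" "s \<otimes> r = \<one>" using unit_if_notin_max[OF cr(2)] by blast
    have "y \<otimes> r \<in> D 1" using ideal_minusD[OF i1(1), of c "y \<otimes> r"] cr w i1(2) y by auto
    hence "s \<otimes> (y \<otimes> r) \<in> D 1" using ideal.I_l_closed[OF i1(1)] s by simp
    moreover have "s \<otimes> (y \<otimes> r) = y \<otimes> (s \<otimes> r)" using s(1) cr(2) y by algebra
    ultimately have "y \<in> D 1" using s y by simp
    hence "C <+> scale y (carrier R) \<subseteq> D 1" using i1 by (intro add_ideals_least principal_least)
    moreover have "D 2 \<subseteq> C <+> scale y (carrier R)" using D(1)[OF n(5)] by (auto simp: ideals_between_iff)
    moreover have "D 1 \<subset> D 2" using D(2)[OF n(2)] by (simp add: numeral_2_eq_2)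
    ultimately show False by blast
  qed
  thus "enat n \<le> enat 1" by simp
qed

text \<open>Let \<open>C\<close> be maximal among the ideals between \<open>A\<close> and
  \<open>B\<close> that have finite length over \<open>A\<close>. If \<open>C \<noteq> B\<close>,
  then \<open>B/C\<close> has a nonzero socle element, and adjoining it adds at most one to the
  length, against maximality.\<close>

lemma len_finite:
  assumes A: "ideal A R" and B: "ideal B R" and AB: "A \<subseteq> B" and sat: "B \<subseteq> sat A"
  shows "len A B \<noteq> \<infinity>"
proof -
  let ?F = "{C. ideal C R \<and> A \<subseteq> C \<and> C \<subseteq> B \<and> len A C \<noteq> \<infinity>}"
  have "A \<in> ?F" using A AB len_self[of A] by (simp add: zero_enat_def)
  hence "?F \<noteq> {}" by blast
  then obtain C where C: "C \<in> ?F" "\<And>D. D \<in> ?F \<Longrightarrow> C \<subseteq> D \<Longrightarrow> D = C" by (rule exists_maximal_ideal_in) auto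
  hence iC: "ideal C R" "A \<subseteq> C" "C \<subseteq> B" "len A C \<noteq> \<infinity>" by auto
  have "B \<subseteq> C"
  proof
    fix b assume b: "b \<in> B"
    have bc: "b \<in> carrier R" using ideal.Icarr[OF B b] .
    show "b \<in> C"
    proof (rule ccontr)
      assume "b \<notin> C"
      obtain k where "\<forall>a\<in>\<mm> ^^^ k. a \<otimes> b \<in> A" using b sat by (auto simp: sat_def)
      hence ex: "\<exists>k. \<forall>a\<in>\<mm> ^^^ k. a \<otimes> b \<in> C" using iC(2) by blast
      \<comment> \<open>For the least \<open>k\<close> with \<open>\<mm>^k b \<subseteq> C\<close>
        there is an \<open>a \<in> \<mm>^(k-1)\<close> with \<open>a b \<notin> C\<close>; this
        \<open>a b\<close> is the socle element.\<close>
      define k where "k = (LEAST k. \<forall>a\<in>\<mm> ^^^ k. a \<otimes> b \<in> C)"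
      have k: "\<forall>a\<in>\<mm> ^^^ k. a \<otimes> b \<in> C" unfolding k_def using ex by (rule LeastI_ex)
      have "k \<noteq> 0" using k \<open>b \<notin> C\<close> bc by (metis ideal_power_0 l_one one_closed)
      then obtain j where j: "k = Suc j" by (cases k) auto
      have "\<not> (\<forall>a\<in>\<mm> ^^^ j. a \<otimes> b \<in> C)" using not_less_Least[of j "\<lambda>k. \<forall>a\<in>\<mm> ^^^ k. a \<otimes> b \<in> C"] j
        unfolding k_def by simp
      then obtain a where a: "a \<in> \<mm> ^^^ j" "a \<otimes> b \<notin> C" by blast
      have ac: "a \<in> carrier R" using a(1) max_ideal by simp
      let ?y = "a \<otimes> b" and ?D = "C <+> scale (a \<otimes> b) (carrier R)"
      have yB: "?y \<in> B" using ideal.I_l_closed[OF B b ac] .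
      have yc: "?y \<in> carrier R" using ac bc by simp
      have "?y \<otimes> t \<in> C" if "t \<in> \<mm>" for t
      proof -
        have "a \<otimes> t \<in> \<mm> ^^^ k" unfolding j ideal_power_Suc using a(1) that by (rule ideal_prod.prod)
        hence "(a \<otimes> t) \<otimes> b \<in> C" using k by blast
        thus ?thesis using ac bc Icarr[OF that] by (simp add: m_ac)
      qed
      from len_add_principal_le[OF iC(1) yc this] have "len C ?D \<noteq> \<infinity>" by (metis enat_ord_code(5))
      moreover have D: "ideal ?D R" "C \<subseteq> ?D" "?y \<in> ?D" using subset_add_principal[OF iC(1) yc] by auto
      ultimately have "len A ?D \<noteq> \<infinity>" using len_add[OF A iC(1) D(1) iC(2) D(2)] iC(4) by auto
      moreover have "?D \<subseteq> B" by (intro add_ideals_least B iC principal_least yB)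
      ultimately have "?D = C" using C(2)[of ?D] D iC(2) by blast
      thus False using D(3) a(2) by simp
    qed
  qed
  thus ?thesis using iC by (simp add: subset_antisym)
qed

text \<open>By prime avoidance, some \<open>z \<in> \<mm>\<close> lies outside the finitely many minimal primes other than \<open>\<mm>\<close>;
  then \<open>\<mm>\<close> is the only prime containing \<open>z\<close>.\<close>

lemma exists_parameter:
  assumes minimal: "\<And>P Q. primeideal P R \<Longrightarrow> P \<noteq> \<mm> \<Longrightarrow> primeideal Q R \<Longrightarrow> Q \<subseteq> P \<Longrightarrow> Q = P"
  shows "\<exists>z\<in>\<mm>. \<exists>c. \<mm> ^^^ c \<subseteq> scale z (carrier R)"
proof -
  obtain Ps where Ps: "finite Ps" "\<forall>P\<in>Ps. primeideal P R"
    "\<And>Q. primeideal Q R \<Longrightarrow> {\<zero>} \<subseteq> Q \<Longrightarrow> \<exists>P\<in>Ps. P \<subseteq> Q"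
    using finite_minimal_primes[OF zeroideal] by blast
  have iP: "ideal P R" if "primeideal P R" for P using primeideal.axioms(1)[OF that] .
  have in_max: "P \<subseteq> \<mm>" if "primeideal P R" for P
    using proper_ideal_subset_max[OF iP[OF that]] primeideal.I_notcarr[OF that] by auto
  \<comment> \<open>The witness is a product of an element of \<open>\<mm>\<close> outside
    \<open>P\<close> with one element of \<open>Q - P\<close> for each \<open>Q \<in> S\<close>. The
    latter exist because \<open>P\<close> is minimal, and primality keeps the product outside
    \<open>P\<close>.\<close>
  have sep: "\<exists>w\<in>\<mm>. w \<notin> P \<and> (\<forall>Q\<in>S. w \<in> Q)"
    if P: "primeideal P R" "P \<noteq> \<mm>" and S: "finite S" "\<forall>Q\<in>S. primeideal Q R" "P \<notin> S" for P S
    using S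
  proof (induction S)
    case empty
    show ?case using in_max[OF P(1)] P(2) by blast
  next
    case (insert Q S)
    then obtain w where w: "w \<in> \<mm>" "w \<notin> P" "\<forall>Q\<in>S. w \<in> Q" by auto
    have Q: "primeideal Q R" using insert by simp
    have "\<not> Q \<subseteq> P" using minimal[OF P Q] insert by auto
    then obtain q where q: "q \<in> Q" "q \<notin> P" by blast
    have c: "w \<in> carrier R" "q \<in> carrier R" using Icarr[OF w(1)] ideal.Icarr[OF iP[OF Q] q(1)] by auto
    have "w \<otimes> q \<notin> P" using primeideal.I_prime[OF P(1) c] w q by blast
    moreover have "w \<otimes> q \<in> \<mm>" using I_r_closed[OF w(1) c(2)] .
    moreover have "w \<otimes> q \<in> Q" using ideal.I_l_closed[OF iP[OF Q] q(1) c(1)] .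
    moreover have "w \<otimes> q \<in> Q'" if "Q' \<in> S" for Q'
      using ideal.I_r_closed[OF iP, of Q' w q] that insert.prems w(3) c by auto
    ultimately show ?case by auto
  qed
  have avoid: "\<exists>z\<in>\<mm>. \<forall>P\<in>S. z \<notin> P" if "finite S" "\<forall>Q\<in>S. primeideal Q R \<and> Q \<noteq> \<mm>" for S
    using that
  proof (induction S)
    case empty
    show ?case using ideal_zero_mem[OF max_ideal] by blast
  next
    case (insert P S)
    then obtain z where z: "z \<in> \<mm>" "\<forall>P\<in>S. z \<notin> P" by auto
    show ?case
    proof (cases "z \<in> P")
      case True
      \<comment> \<open>Adding \<open>w\<close> moves \<open>z\<close> out of \<open>P\<close> and
        leaves its class modulo the primes in \<open>S\<close> unchanged.\<close>
      obtain w where w: "w \<in> \<mm>" "w \<notin> P" "\<forall>Q\<in>S. w \<in> Q" using sep[of P S] insert by auto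
      have c: "w \<in> carrier R" "z \<in> carrier R" using Icarr w(1) z(1) by auto
      have "z \<oplus> w \<notin> P" using ideal_minusD[OF iP, of P z w] True w(2) c insert.prems by auto
      moreover have "z \<oplus> w \<notin> Q" if "Q \<in> S" for Q
        using ideal_minusD[OF iP, of Q w z] that w(3) z(2) c insert.prems by (auto simp: a_comm)
      moreover have "z \<oplus> w \<in> \<mm>" using z w by (intro ideal_add_mem max_ideal)
      ultimately show ?thesis by auto
    next
      case False
      thus ?thesis using z by blast
    qed
  qed
  have "finite {P\<in>Ps. P \<noteq> \<mm>}" "\<forall>Q\<in>{P\<in>Ps. P \<noteq> \<mm>}. primeideal Q R \<and> Q \<noteq> \<mm>" using Ps(1,2) by simp_all
  then obtain z where z: "z \<in> \<mm>" "\<And>P. P \<in> Ps \<Longrightarrow> P \<noteq> \<mm> \<Longrightarrow> z \<notin> P" using avoid by (smt (verit) mem_Collect_eq)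
  have zc: "z \<in> carrier R" using Icarr[OF z(1)] .
  let ?Z = "scale z (carrier R)"
  \<comment> \<open>A prime \<open>Q \<noteq> \<mm>\<close> is minimal, so it belongs to
    \<open>Ps\<close>, and \<open>z\<close> was chosen outside it.\<close>
  have only_max: "Q = \<mm>" if Q: "primeideal Q R" "?Z \<subseteq> Q" for Q
  proof (rule ccontr)
    assume ne: "Q \<noteq> \<mm>"
    obtain P where P: "P \<in> Ps" "P \<subseteq> Q" using Ps(3)[OF Q(1)] ideal_zero_mem[OF iP[OF Q(1)]] by auto
    hence "P = Q" using minimal[OF Q(1) ne] Ps(2) by auto
    thus False using z(2)[OF P(1)] ne Q(2) principal_self[OF zc] by auto
  qed
  \<comment> \<open>With the constant family \<open>W n = zR\<close>, the lemma passes from powers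
    of single elements of \<open>\<mm>\<close> to one power of the ideal
    \<open>\<mm>\<close>.\<close>
  have "\<exists>c. \<mm> ^^^ c \<subseteq> ?Z"
  proof (rule ideal_power_subset_if_pow_mem[OF max_ideal])
    show Z: "ideal ?Z R" by (rule principal_ideal[OF zc])
    show "\<exists>p::nat. a [^] p \<in> ?Z" if "a \<in> \<mm>" for a
      using pow_mem_if_mem_primes[OF Z Icarr[OF that]] only_max that by blast
    show "a \<otimes> b \<in> ?Z" if "a \<in> ?Z" "b \<in> \<mm>" for a b
      using ideal.I_r_closed[OF Z that(1) Icarr[OF that(2)]] .
  qed
  thus ?thesis using z(1) by blast
qed

end

section \<open>\<open>H^0_\<mm>(R/J)\<close> as an interval of ideals\<close>

context noetherian_local_ring
begin

text \<open>The coset of \<open>r\<close> is killed by \<open>\<mm>^k\<close> iff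
  \<open>\<mm>^k r \<subseteq> J\<close>, so the local cohomology is \<open>sat J / J\<close>.
  Preimages and images under \<open>r \<mapsto> J + r\<close> are strictly monotone maps between its
  submodules and the ideals from \<open>J\<close> to \<open>sat J\<close>, and give the two
  inequalities.\<close>

lemma module_length_local_cohomology0:
  assumes J: "ideal J R"
  shows "module_length R (local_cohomology0 R \<mm> (quot_module R J)) = len J (sat J)"
proof -
  interpret J: ideal J R by (rule J)
  interpret Q: module R "quot_module R J" by (rule module_quot_module[OF is_cring J])
  let ?Q = "quot_module R J"
  let ?H = "local_cohomology0 R \<mm> ?Q"
  have "submodule (carrier ?H) R ?Q"
    by (rule submodule_local_cohomology0[OF Q.module_axioms max_ideal])
  from submodule.submodule_is_module[OF this Q.module_axioms]
  have "module R ?H" by (simp add: local_cohomology0_def)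
  then interpret H: module R ?H .
  have hom: "(+>) J \<in> ring_hom R (R Quot J)" by (rule J.rcos_ring_hom)
  have ops: "\<zero>\<^bsub>?H\<^esub> = J" "x \<oplus>\<^bsub>?H\<^esub> y = x \<oplus>\<^bsub>R Quot J\<^esub> y" "a \<odot>\<^bsub>?H\<^esub> x = (J +> a) \<otimes>\<^bsub>R Quot J\<^esub> x" for x y a
    by (simp_all add: local_cohomology0_def FactRing_def)
  have add: "(J +> a) \<oplus>\<^bsub>?H\<^esub> (J +> b) = J +> (a \<oplus> b)" and smult: "a \<odot>\<^bsub>?H\<^esub> (J +> b) = J +> (a \<otimes> b)"
    if "a \<in> carrier R" "b \<in> carrier R" for a b
    using ring_hom_add[OF hom that] ring_hom_mult[OF hom that] by (simp_all add: ops)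
  have zero_iff: "J +> a = J \<longleftrightarrow> a \<in> J" if "a \<in> carrier R" for a
    using J.rcos_const_imp_mem[OF that] a_rcos_zero[OF J] by blast
  have carr: "A \<in> carrier ?H \<longleftrightarrow> (\<exists>r\<in>sat J. A = J +> r)" for A
  proof -
    have ann: "(\<forall>a\<in>\<mm> ^^^ k. (J +> a) \<otimes>\<^bsub>R Quot J\<^esub> (J +> r) = J) \<longleftrightarrow> (\<forall>a\<in>\<mm> ^^^ k. a \<otimes> r \<in> J)"
      if r: "r \<in> carrier R" for r k
    proof (rule ball_cong[OF refl])
      fix a assume "a \<in> \<mm> ^^^ k"
      hence a: "a \<in> carrier R" using max_ideal by simp
      show "(J +> a) \<otimes>\<^bsub>R Quot J\<^esub> (J +> r) = J \<longleftrightarrow> a \<otimes> r \<in> J"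
        using ring_hom_mult[OF hom a r] zero_iff[of "a \<otimes> r"] a r by simp
    qed
    have "A \<in> carrier ?H \<longleftrightarrow> A \<in> carrier (R Quot J) \<and> (\<exists>k. \<forall>a\<in>\<mm> ^^^ k. (J +> a) \<otimes>\<^bsub>R Quot J\<^esub> A = J)"
      by (simp add: local_cohomology0_def ideal_power_def FactRing_def)
    also have "A \<in> carrier (R Quot J) \<longleftrightarrow> (\<exists>r\<in>carrier R. A = J +> r)"
      by (auto simp: FactRing_def A_RCOSETS_def')
    finally show ?thesis unfolding sat_def using ann by blast
  qed
  have satc: "r \<in> carrier R" if "r \<in> sat J" for r using that by (simp add: sat_def)
  have coset_eq: "r \<in> B" if B: "ideal B R" "J \<subseteq> B" "b \<in> B" "r \<in> carrier R" "J +> r = J +> b" for r b B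
  proof -
    have "r \<ominus> b \<in> B" using quotient_eq_iff_same_a_r_cos[OF J B(4) ideal.Icarr[OF B(1,3)]] B(2,5) by blast
    thus ?thesis using add_minus_cancel_mem[OF B(1) _ B(3,4)] by simp
  qed
  have "chain_height {N. submodule N R ?H} \<le> chain_height (ideals_between J (sat J))"
  proof (rule chain_height_le[of _ "\<lambda>N. {r \<in> carrier R. J +> r \<in> N}"])
    fix N assume "N \<in> {N. submodule N R ?H}"
    hence N: "submodule N R ?H" by simp
    note NE = H.submoduleE[OF N]
    have zN: "J \<in> N"
    proof -
      obtain x where "x \<in> N" using NE(2) by blast
      hence "\<zero> \<odot>\<^bsub>?H\<^esub> x \<in> N" using NE(4) by simp
      moreover have "\<zero> \<odot>\<^bsub>?H\<^esub> x = J" using H.smult_l_null NE(1) \<open>x \<in> N\<close> ops(1) by auto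
      ultimately show ?thesis by simp
    qed
    have "ideal {r \<in> carrier R. J +> r \<in> N} R"
    proof (rule cring_idealI)
      show "\<zero> \<in> {r \<in> carrier R. J +> r \<in> N}" using zN zero_iff[of \<zero>] J.zero_closed by simp
    next
      fix a b assume "a \<in> {r \<in> carrier R. J +> r \<in> N}" "b \<in> {r \<in> carrier R. J +> r \<in> N}"
      thus "a \<oplus> b \<in> {r \<in> carrier R. J +> r \<in> N}" using NE(5) add by fastforce
    next
      fix a r assume "a \<in> {r \<in> carrier R. J +> r \<in> N}" "r \<in> carrier R"
      thus "r \<otimes> a \<in> {r \<in> carrier R. J +> r \<in> N}" using NE(4) smult by fastforce
    qed auto
    moreover have "J \<subseteq> {r \<in> carrier R. J +> r \<in> N}" 
    proof
      fix r assume r: "r \<in> J"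
      thus "r \<in> {r \<in> carrier R. J +> r \<in> N}" using zN zero_iff[OF J.Icarr[OF r]] J.Icarr[OF r] by simp
    qed
    moreover have "{r \<in> carrier R. J +> r \<in> N} \<subseteq> sat J"
    proof
      fix r assume r: "r \<in> {r \<in> carrier R. J +> r \<in> N}"
      hence "J +> r \<in> carrier ?H" using NE(1) by blast
      then obtain s where "s \<in> sat J" "J +> r = J +> s" unfolding carr by blast
      thus "r \<in> sat J" using coset_eq[OF sat_ideal[OF J] subset_sat[OF J]] r by simp
    qed
    ultimately show "{r \<in> carrier R. J +> r \<in> N} \<in> ideals_between J (sat J)"
      unfolding ideals_between_iff by blast
  next
    fix N N' assume "N \<in> {N. submodule N R ?H}" "N' \<in> {N. submodule N R ?H}" "N \<subset> N'"
    then obtain A where A: "A \<in> N'" "A \<notin> N" "A \<in> carrier ?H" using H.submoduleE(1)[of N'] by blast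
    then obtain r where "r \<in> carrier R" "A = J +> r" unfolding carr using satc by blast
    thus "{r \<in> carrier R. J +> r \<in> N} \<subset> {r \<in> carrier R. J +> r \<in> N'}" using A \<open>N \<subset> N'\<close> by blast
  qed
  moreover have "chain_height (ideals_between J (sat J)) \<le> chain_height {N. submodule N R ?H}"
  proof (rule chain_height_le[of _ "\<lambda>B. (+>) J ` B"])
    fix B assume "B \<in> ideals_between J (sat J)"
    hence B: "ideal B R" "J \<subseteq> B" "B \<subseteq> sat J" by (auto simp: ideals_between_iff)
    note Bc = ideal.Icarr[OF B(1)]
    have sub: "(+>) J ` B \<subseteq> carrier ?H" using B(3) carr by blast
    have sm: "a \<odot>\<^bsub>?H\<^esub> x \<in> (+>) J ` B" if a: "a \<in> carrier R" and x: "x \<in> (+>) J ` B" for a x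
    proof -
      from x obtain b where b: "b \<in> B" "x = J +> b" by blast
      show ?thesis unfolding b(2) smult[OF a Bc[OF b(1)]] using ideal.I_l_closed[OF B(1) b(1) a] by blast
    qed
    have "submodule ((+>) J ` B) R ?H"
    proof (rule H.submoduleI[OF sub])
      have "J +> \<zero> = J" using zero_iff[of \<zero>] J.zero_closed by simp
      thus "\<zero>\<^bsub>?H\<^esub> \<in> (+>) J ` B" using ideal_zero_mem[OF B(1)] ops(1) by (metis imageI)
    next
      fix x assume x: "x \<in> (+>) J ` B"
      hence "\<ominus>\<^bsub>?H\<^esub> x = (\<ominus> \<one>) \<odot>\<^bsub>?H\<^esub> x" using H.smult_l_minus[of \<one> x] sub by (auto simp: subset_iff)
      thus "\<ominus>\<^bsub>?H\<^esub> x \<in> (+>) J ` B" using sm[OF _ x, of "\<ominus> \<one>"] by simp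
    next
      fix x y assume "x \<in> (+>) J ` B" "y \<in> (+>) J ` B"
      then obtain a b where ab: "a \<in> B" "b \<in> B" "x = J +> a" "y = J +> b" by blast
      show "x \<oplus>\<^bsub>?H\<^esub> y \<in> (+>) J ` B" unfolding ab(3,4) add[OF Bc[OF ab(1)] Bc[OF ab(2)]]
        using ideal_add_mem[OF B(1) ab(1,2)] by blast
    qed (rule sm)
    thus "(+>) J ` B \<in> {N. submodule N R ?H}" by simp
  next
    fix B B' assume B: "B \<in> ideals_between J (sat J)" "B' \<in> ideals_between J (sat J)" "B \<subset> B'"
    then obtain r where r: "r \<in> B'" "r \<notin> B" by blast
    have iB: "ideal B R" "J \<subseteq> B" "r \<in> carrier R" using B r by (auto simp: ideals_between_iff ideal.Icarr)
    have "J +> r \<notin> (+>) J ` B" using coset_eq[OF iB(1,2) _ iB(3)] r(2) by blast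
    thus "(+>) J ` B \<subset> (+>) J ` B'" using r(1) B(3) by blast
  qed
  ultimately show ?thesis unfolding module_length_def len_def by (rule antisym)
qed

end

section \<open>Parameters\<close>

locale local_ring_with_parameter = noetherian_local_ring +
  fixes z c
  assumes parameter: "z \<in> \<mm>" and max_power_subset: "\<mm> ^^^ c \<subseteq> scale z (carrier R)"
begin

lemma parameter_carrier [simp]: "z \<in> carrier R"
  using Icarr[OF parameter] .

lemma len_parameter_finite: "len (scale z (carrier R)) (carrier R) \<noteq> \<infinity>"
proof (rule len_finite)
  show Z: "ideal (scale z (carrier R)) R" by (simp add: principal_ideal)
  show "scale z (carrier R) \<subseteq> carrier R" using ideal_subset[OF Z] .
  show "carrier R \<subseteq> sat (scale z (carrier R))"
    using max_power_subset ideal.I_r_closed[OF Z] by (intro subset_sat_if_power[of _ c]) auto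
qed (rule oneideal)

text \<open>If \<open>\<mm>^k z f \<subseteq> A\<close>, then
  \<open>\<mm>^(k+c) f \<subseteq> \<mm>^k z f R \<subseteq> A\<close>. Thus \<open>z\<close> acts
  injectively on \<open>R / sat A\<close>, although it may be a zero divisor in
  \<open>R\<close>.\<close>

lemma mem_sat_if_mult_mem:
  assumes A: "ideal A R" and f: "f \<in> carrier R" "z \<otimes> f \<in> sat A"
  shows "f \<in> sat A"
proof -
  obtain k where k: "\<forall>a\<in>\<mm> ^^^ k. a \<otimes> (z \<otimes> f) \<in> A" using f(2) by (auto simp: sat_def)
  have "\<mm> ^^^ (k + c) \<subseteq> colon A f" unfolding ideal_power_add[OF max_ideal]
  proof (rule ideal_prod_least)
    show "ideal (colon A f) R" using f A by (simp add: colon_ideal)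
    fix a b assume a: "a \<in> \<mm> ^^^ k" and b: "b \<in> \<mm> ^^^ c"
    then obtain r where r: "r \<in> carrier R" "b = z \<otimes> r" using max_power_subset by auto
    have ac: "a \<in> carrier R" using a max_ideal by simp
    have "(a \<otimes> (z \<otimes> f)) \<otimes> r \<in> A" using ideal.I_r_closed[OF A _ r(1)] k a by blast
    also have "(a \<otimes> (z \<otimes> f)) \<otimes> r = f \<otimes> (a \<otimes> b)" unfolding r(2) using ac f r(1) parameter_carrier by algebra
    finally show "a \<otimes> b \<in> colon A f" using ac r by (simp add: colon_def)
  qed
  hence "\<forall>a\<in>\<mm> ^^^ (k + c). a \<otimes> f \<in> A" using f by (auto simp: colon_def m_comm)
  thus ?thesis using f unfolding sat_def by blast
qed

lemma sat_Int_parameter: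
  assumes A: "ideal A R"
  shows "sat A \<inter> scale z (carrier R) = scale z (sat A)"
proof
  show "scale z (sat A) \<subseteq> sat A \<inter> scale z (carrier R)"
    using scale_subset[OF parameter_carrier sat_ideal[OF A]] ideal_subset[OF sat_ideal[OF A]] by blast
  show "sat A \<inter> scale z (carrier R) \<subseteq> scale z (sat A)"
    using mem_sat_if_mult_mem[OF A] by blast
qed

text \<open>This bounds the minimal number of generators of all ideals at once.  The saturation \<open>S\<close> of \<open>N\<close>
  satisfies \<open>S \<inter> zR = zS\<close>, so \<open>S/zS\<close> embeds into \<open>R/zR\<close>, while \<open>N/zN\<close> is no longer than \<open>S/zS\<close>
  because \<open>S/N\<close> has finite length and surjects onto \<open>zS/zN\<close>.\<close>

lemma len_max_mult_le:
  assumes N: "ideal N R"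
  shows "len (\<mm> \<cdot> N) N \<le> len (scale z (carrier R)) (carrier R)"
proof -
  let ?S = "sat N" and ?e = "len (scale z (carrier R)) (carrier R)"
  have S: "ideal ?S R" "N \<subseteq> ?S" using sat_ideal[OF N] subset_sat[OF N] by auto
  have i: "ideal (scale z N) R" "ideal (scale z ?S) R" using scale_ideal[OF parameter_carrier] N S by auto
  have s: "scale z N \<subseteq> N" "scale z ?S \<subseteq> ?S" "scale z N \<subseteq> scale z ?S"
    using scale_subset[OF parameter_carrier] N S by blast+
  have fin: "len N ?S \<noteq> \<infinity>" using len_finite[OF N S] by simp
  \<comment> \<open>The routes \<open>zN \<subseteq> N \<subseteq> S\<close> and
    \<open>zN \<subseteq> zS \<subseteq> S\<close> give the same total length; the finite
    \<open>len N ?S\<close> then cancels.\<close>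
  have "len (scale z N) N + len N ?S = len (scale z N) (scale z ?S) + len (scale z ?S) ?S"
    using len_add[OF i(1) N S(1) s(1) S(2)] len_add[OF i(1,2) S(1) s(3,2)] by simp
  also have "\<dots> \<le> len N ?S + ?e"
    using len_scale_le[OF parameter_carrier N S] len_Int_le[OF S(1) principal_ideal[OF parameter_carrier]]
    unfolding sat_Int_parameter[OF N] by (rule add_mono)
  finally have "len (scale z N) N \<le> ?e" using fin
    by (cases "len (scale z N) N"; cases ?e; cases "len N ?S") auto
  moreover have "scale z N \<subseteq> \<mm> \<cdot> N" using parameter by (auto intro: ideal_prod.prod)
  ultimately show ?thesis using len_mono[of "scale z N" "\<mm> \<cdot> N" N N] by auto
qed

lemma sat_stabilizes:
  fixes A :: "nat \<Rightarrow> 'a set"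
  assumes A: "\<And>n. ideal (A n) R" and dec: "\<And>m n. m \<le> n \<Longrightarrow> A n \<subseteq> A m"
  shows "\<exists>n0. \<forall>n\<ge>n0. sat (A n) = sat (A n0)"
proof -
  let ?Z = "scale z (carrier R)"
  define T where "T n = sat (A n) <+> ?Z" for n
  have Z: "ideal ?Z R" by (simp add: principal_ideal)
  have S: "ideal (sat (A n)) R" for n using sat_ideal[OF A] .
  have T: "ideal (T n) R" "?Z \<subseteq> T n" for n unfolding T_def using add_ideals[OF S Z] add_right_subset[OF S Z] by auto
  have Tdec: "T n \<subseteq> T m" if "m \<le> n" for m n unfolding T_def
    using sat_mono[OF dec[OF that]] by (intro set_add_mono) auto
  have fin: "len ?Z (T n) \<noteq> \<infinity>" for n
    using len_mono[OF subset_refl ideal_subset[OF T(1)], of ?Z n] len_parameter_finite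
    by (metis enat_ord_simps(5))
  define t where "t n = the_enat (len ?Z (T n))" for n
  have t: "len ?Z (T n) = enat (t n)" for n unfolding t_def using fin[of n] by auto
  \<comment> \<open>The natural numbers \<open>t n\<close> attain a minimum, and from there on the
    descending \<open>T n\<close> cannot shrink any more.\<close>
  obtain n0 where n0: "\<And>n. t n0 \<le> t n" using ex_has_least_nat[of "\<lambda>_. True" 0 t] by blast
  have "sat (A n) = sat (A n0)" if n: "n \<ge> n0" for n
  proof -
    have "len ?Z (T n0) = len ?Z (T n) + len (T n) (T n0)"
      by (rule len_add[OF Z T(1) T(1) T(2) Tdec[OF n]])
    hence "len (T n) (T n0) = 0" using t[of n] t[of n0] n0[of n]
      by (cases "len (T n) (T n0)") (auto simp: zero_enat_def)
    hence "T n = T n0" by (intro len_eq_0D T Tdec n)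
    have "sat (A n0) \<subseteq> sat (A n) <+> \<mm> \<cdot> sat (A n0)"
    proof
      fix f assume f: "f \<in> sat (A n0)"
      hence "f \<in> T n" using \<open>T n = T n0\<close> add_left_subset[OF S Z] unfolding T_def by auto
      then obtain s w where sw: "s \<in> sat (A n)" "w \<in> ?Z" "f = s \<oplus> w" unfolding T_def by (rule set_add_memE)
      have "s \<in> sat (A n0)" using sw(1) sat_mono[OF dec[OF n]] by auto
      hence "w \<in> sat (A n0)" using ideal_minusD[OF S, of s n0 w] f sw ideal.Icarr[OF Z] by auto
      hence "w \<in> scale z (sat (A n0))" using sw(2) sat_Int_parameter[OF A, of n0] by blast
      hence "w \<in> \<mm> \<cdot> sat (A n0)" using parameter by (auto intro: ideal_prod.prod)
      thus "f \<in> sat (A n) <+> \<mm> \<cdot> sat (A n0)" using sw by (auto intro: set_add_memI)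
    qed
    from nakayama[OF S S sat_mono[OF dec[OF n]] this] show ?thesis by simp
  qed
  thus ?thesis by blast
qed

end

section \<open>Elements of the fiber cone\<close>

text \<open>The fiber cone of \<open>I\<close> is the graded ring with pieces \<open>I\<^sup>n/\<mm>I\<^sup>n\<close>; its homogeneous elements are
  handled through representatives in \<open>I\<^sup>n\<close>, modulo \<open>Z n = \<mm>I\<^sup>n\<close>.\<close>

locale bounded_fiber_cone = noetherian_local_ring +
  fixes I and e :: nat
  assumes I: "ideal I R" and len_fiber_le: "\<And>n. len (\<mm> \<cdot> (I ^^^ n)) (I ^^^ n) \<le> enat e"
begin

definition Z :: "nat \<Rightarrow> 'a set" where
  "Z n = \<mm> \<cdot> (I ^^^ n)"

lemma Z_ideal: "ideal (Z n) R"
  unfolding Z_def by (intro ideal_prod_is_ideal max_ideal ideal_power_ideal I)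

lemma Z_subset: "Z n \<subseteq> I ^^^ n"
  unfolding Z_def using ideal_prod_inter[OF max_ideal ideal_power_ideal[OF I]] by blast

lemma pow_carrier: "a \<in> I ^^^ n \<Longrightarrow> a \<in> carrier R"
  by (rule ideal_power_carrier[OF I])

lemma Z_carrier: "a \<in> Z n \<Longrightarrow> a \<in> carrier R"
  by (rule ideal.Icarr[OF Z_ideal])

lemma pow_mult_mem: "a \<in> I ^^^ m \<Longrightarrow> b \<in> I ^^^ n \<Longrightarrow> a \<otimes> b \<in> I ^^^ (m + n)"
  by (rule ideal_power_mult_mem[OF I])

lemma Z_mult:
  assumes "a \<in> Z m" "b \<in> I ^^^ n"
  shows "a \<otimes> b \<in> Z (m + n)"
proof -
  have bc: "b \<in> carrier R" using pow_carrier[OF assms(2)] .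
  have "Z m \<subseteq> colon (Z (m + n)) b" unfolding Z_def[of m]
  proof (rule ideal_prod_least[OF colon_ideal[OF bc Z_ideal]])
    fix t i assume t: "t \<in> \<mm>" and i: "i \<in> I ^^^ m"
    have c: "t \<in> carrier R" "i \<in> carrier R" using Icarr[OF t] pow_carrier[OF i] by auto
    have "t \<otimes> (i \<otimes> b) \<in> Z (m + n)" unfolding Z_def using t pow_mult_mem[OF i assms(2)] by (rule ideal_prod.prod)
    also have "t \<otimes> (i \<otimes> b) = b \<otimes> (t \<otimes> i)" using c bc by algebra
    finally show "t \<otimes> i \<in> colon (Z (m + n)) b" using c by (simp add: colon_def)
  qed
  hence "b \<otimes> a \<in> Z (m + n)" using assms(1) by (auto simp: colon_def)
  thus ?thesis using m_comm[OF bc Z_carrier[OF assms(1)]] by simp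
qed

lemma Z_mult': "a \<in> I ^^^ m \<Longrightarrow> b \<in> Z n \<Longrightarrow> a \<otimes> b \<in> Z (m + n)"
  using Z_mult[of b n a m] m_comm[of a b] pow_carrier[of a m] Z_carrier[of b n] by (simp add: add.commute)

text \<open>Nilpotency of the class of \<open>y\<close> in degree \<open>n\<close> of the fiber
  cone. The degree is an argument because \<open>y\<close> may lie in several powers of
  \<open>I\<close>. The exponent \<open>j = 0\<close> is never a witness, as
  \<open>Z 0 \<subseteq> \<mm>\<close> does not contain \<open>\<one>\<close>.\<close>

definition nil :: "'a \<Rightarrow> nat \<Rightarrow> bool" where
  "nil y n \<longleftrightarrow> (\<exists>j::nat. y [^] j \<in> Z (j * n))"

lemma nil_if_nil_pow: "y \<in> carrier R \<Longrightarrow> nil (y [^] (m::nat)) (m * n) \<Longrightarrow> nil y n"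
  unfolding nil_def by (metis mult.assoc mult.commute nat_pow_pow)

lemma pow_pow_mem: "y \<in> I ^^^ n \<Longrightarrow> y [^] (m::nat) \<in> I ^^^ (m * n)"
  by (rule pow_mem_ideal_power[OF I])

lemma pow_mem_Z:
  assumes "y \<in> Z n" "0 < m"
  shows "y [^] (m::nat) \<in> Z (m * n)"
proof -
  obtain k where k: "m = Suc k" using assms(2) by (cases m) auto
  have "y \<in> I ^^^ n" using assms(1) Z_subset by blast
  from Z_mult'[OF pow_pow_mem[OF this, of k] assms(1)] show ?thesis by (simp add: k add.commute)
qed

section \<open>Orthogonal families in the fiber cone\<close>

definition orthogonal :: "nat \<Rightarrow> nat \<Rightarrow> (nat \<Rightarrow> 'a) \<Rightarrow> bool" where
  "orthogonal s d v \<longleftrightarrow> 0 < d \<and> (\<forall>i<s. v i \<in> I ^^^ d \<and> \<not> nil (v i) d) \<and>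
     (\<forall>i<s. \<forall>j<s. i \<noteq> j \<longrightarrow> v i \<otimes> v j \<in> Z (2 * d))"

text \<open>The ideals \<open>G i\<close>, generated by \<open>v 0, ..., v (i - 1)\<close> over
  \<open>Z d\<close>, form a strict chain inside \<open>I^d\<close>: modulo
  \<open>Z (2 * d)\<close>, the element \<open>v i\<close> annihilates \<open>G i\<close> but not
  itself, being non-nilpotent.\<close>

lemma orthogonal_le:
  assumes "orthogonal s d v"
  shows "s \<le> e"
proof -
  have v: "v i \<in> I ^^^ d" "v i \<in> carrier R" "\<not> nil (v i) d" if "i < s" for i
    using assms that pow_carrier unfolding orthogonal_def by blast+
  have vv: "v i \<otimes> v j \<in> Z (2 * d)" if "i < s" "j < s" "i \<noteq> j" for i j
    using assms that unfolding orthogonal_def by blast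
  define G where "G = rec_nat (Z d) (\<lambda>i A. A <+> scale (v i) (carrier R))"
  have G0: "G 0 = Z d" and GS: "G (Suc i) = G i <+> scale (v i) (carrier R)" for i unfolding G_def by auto
  have G: "ideal (G i) R \<and> Z d \<subseteq> G i \<and> G i \<subseteq> I ^^^ d \<and> (\<forall>k. i \<le> k \<longrightarrow> k < s \<longrightarrow> G i \<subseteq> colon (Z (2 * d)) (v k))"
    if "i \<le> s" for i
    using that
  proof (induction i)
    case 0
    have "Z d \<subseteq> colon (Z (2 * d)) (v k)" if "k < s" for k
      using Z_mult'[OF v(1)[OF that]] Z_carrier by (auto simp: colon_def mult_2)
    thus ?case using G0 Z_ideal Z_subset by auto
  next
    case (Suc i)
    hence i: "i < s" and IH: "ideal (G i) R" "Z d \<subseteq> G i" "G i \<subseteq> I ^^^ d"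
      "\<And>k. i \<le> k \<Longrightarrow> k < s \<Longrightarrow> G i \<subseteq> colon (Z (2 * d)) (v k)" by auto
    have "G (Suc i) \<subseteq> colon (Z (2 * d)) (v k)" if k: "Suc i \<le> k" "k < s" for k
      unfolding GS
    proof (intro add_ideals_least principal_least colon_ideal v(2) k Z_ideal)
      show "G i \<subseteq> colon (Z (2 * d)) (v k)" using IH(4)[of k] k by simp
      show "v i \<in> colon (Z (2 * d)) (v k)" using vv[of k i] i k v(2)[OF i] by (simp add: colon_def)
    qed
    moreover have "G (Suc i) \<subseteq> I ^^^ d" unfolding GS
      using IH(3) v(1)[OF i] I by (intro add_ideals_least principal_least) auto
    moreover have "ideal (G (Suc i)) R" "Z d \<subseteq> G (Suc i)"
      unfolding GS using subset_add_principal[OF IH(1) v(2)[OF i]] IH(2) by auto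
    ultimately show ?case by blast
  qed
  have "G i \<subset> G (Suc i)" if i: "i < s" for i
  proof -
    have "v i \<notin> G i"
    proof
      assume "v i \<in> G i"
      hence "v i \<otimes> v i \<in> Z (2 * d)" using G[of i] i by (auto simp: colon_def)
      hence "v i [^] (2::nat) \<in> Z (2 * d)" using v(2)[OF i] by (simp add: numeral_2_eq_2)
      hence "nil (v i) d" unfolding nil_def by blast
      thus False using v(3)[OF i] by simp
    qed
    thus ?thesis unfolding GS using add_principal_strict G[of i] v(2)[OF i] i by auto
  qed
  hence "enat s \<le> len (Z d) (I ^^^ d)" unfolding len_def
    using G by (intro le_chain_heightI[of s G]) (auto simp: ideals_between_iff)
  also have "\<dots> \<le> enat e" unfolding Z_def by (rule len_fiber_le)
  finally show ?thesis by simp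
qed

text \<open>If all the \<open>y a\<close> were nilpotent, \<open>I\<close> would be nilpotent modulo
  the annihilators \<open>W p\<close> of the \<open>y^p\<close>, so \<open>y^p I^p\<close> would
  vanish in the fiber cone for some \<open>p\<close>; then \<open>y^(2p)\<close> would vanish too.
  Positive degree matters: in degree 0 the unit is never nilpotent, even if \<open>I\<close>
  is.\<close>

lemma not_nil_mult:
  assumes y: "y \<in> I ^^^ d" "0 < d" and nn: "\<not> nil y d"
  shows "\<exists>a\<in>I. \<not> nil (y \<otimes> a) (Suc d)"
proof (rule ccontr)
  assume "\<not> ?thesis"
  hence all: "\<exists>p::nat. (y \<otimes> a) [^] p \<in> Z (p * Suc d)" if "a \<in> I" for a using that unfolding nil_def by blast
  have yc: "y \<in> carrier R" using pow_carrier[OF y(1)] .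
  define W where "W p = colon (Z (p * Suc d)) (y [^] p)" for p :: nat
  have W: "ideal (W p) R" for p unfolding W_def using yc by (intro colon_ideal Z_ideal) auto
  have "\<exists>p. I ^^^ p \<subseteq> W p"
  proof (rule ideal_power_subset_if_pow_mem[OF I W])
    fix n a b assume a: "a \<in> W n" and b: "b \<in> I"
    have c: "a \<in> carrier R" "b \<in> carrier R" using ideal.Icarr[OF W a] ideal.Icarr[OF I b] by auto
    have "y \<otimes> b \<in> I ^^^ Suc d" unfolding ideal_power_Suc using y(1) b by (rule ideal_prod.prod)
    hence "(y [^] n \<otimes> a) \<otimes> (y \<otimes> b) \<in> Z (n * Suc d + Suc d)"
      using a by (intro Z_mult) (auto simp: W_def colon_def)
    moreover have "(y [^] n \<otimes> a) \<otimes> (y \<otimes> b) = y [^] Suc n \<otimes> (a \<otimes> b)" using c yc by (simp add: m_ac)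
    ultimately show "a \<otimes> b \<in> W (Suc n)" using c by (simp add: W_def colon_def add_ac)
  next
    fix a assume a: "a \<in> I"
    have ac: "a \<in> carrier R" using ideal.Icarr[OF I a] .
    obtain p :: nat where "(y \<otimes> a) [^] p \<in> Z (p * Suc d)" using all[OF a] by blast
    hence "a [^] p \<in> W p" using ac yc by (simp add: W_def colon_def nat_pow_distrib)
    thus "\<exists>p::nat. a [^] p \<in> W p" by blast
  qed
  then obtain p where p: "I ^^^ p \<subseteq> W p" by blast
  have ypc: "y [^] p \<in> carrier R" using yc by simp
  \<comment> \<open>Multiplying by \<open>I^(p(d-1))\<close> raises the degree \<open>p(d+1)\<close>
    to \<open>2pd\<close>. The factor next to \<open>y^p\<close> becomes \<open>I^(pd)\<close>,
    which contains \<open>y^p\<close> itself; \<open>d > 0\<close> makes \<open>d - 1\<close>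
    exact.\<close>
  have "(I ^^^ p) \<cdot> (I ^^^ (p * (d - 1))) \<subseteq> colon (Z (p * Suc d + p * (d - 1))) (y [^] p)"
  proof (rule ideal_prod_least[OF colon_ideal[OF ypc Z_ideal]])
    fix a b assume a: "a \<in> I ^^^ p" and b: "b \<in> I ^^^ (p * (d - 1))"
    have "(y [^] p \<otimes> a) \<otimes> b \<in> Z (p * Suc d + p * (d - 1))"
      using a p b by (intro Z_mult) (auto simp: W_def colon_def)
    thus "a \<otimes> b \<in> colon (Z (p * Suc d + p * (d - 1))) (y [^] p)"
      using pow_carrier[OF a] pow_carrier[OF b] ypc by (simp add: colon_def m_assoc)
  qed
  moreover have "p + p * (d - 1) = p * d" using y(2) by (cases d) auto
  moreover have "p * Suc d + p * (d - 1) = (p + p) * d" using y(2) by (cases d) (auto simp: algebra_simps)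
  ultimately have "I ^^^ (p * d) \<subseteq> colon (Z ((p + p) * d)) (y [^] p)"
    using ideal_power_add[OF I, of p "p * (d - 1)"] by simp
  hence "y [^] p \<otimes> y [^] p \<in> Z ((p + p) * d)" using pow_pow_mem[OF y(1), of p] by (auto simp: colon_def)
  hence "y [^] (p + p) \<in> Z ((p + p) * d)" using yc by (simp add: nat_pow_mult)
  thus False using nn unfolding nil_def by blast
qed

lemma orthogonal_Suc:
  assumes "orthogonal s d v"
  shows "\<exists>v'. orthogonal s (Suc d) v'"
proof -
  have v: "v i \<in> I ^^^ d" "\<not> nil (v i) d" if "i < s" for i
    using assms that unfolding orthogonal_def by blast+
  have d: "0 < d" using assms unfolding orthogonal_def by blast
  have "\<forall>i. \<exists>a. i < s \<longrightarrow> a \<in> I \<and> \<not> nil (v i \<otimes> a) (Suc d)" using not_nil_mult[OF v(1) d v(2)] by blast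
  then obtain a where a: "\<And>i. i < s \<Longrightarrow> a i \<in> I" "\<And>i. i < s \<Longrightarrow> \<not> nil (v i \<otimes> a i) (Suc d)" by metis
  have "orthogonal s (Suc d) (\<lambda>i. v i \<otimes> a i)" unfolding orthogonal_def
  proof (intro conjI allI impI)
    fix i assume i: "i < s"
    show "v i \<otimes> a i \<in> I ^^^ Suc d" unfolding ideal_power_Suc using v(1)[OF i] a(1)[OF i] by (rule ideal_prod.prod)
    show "\<not> nil (v i \<otimes> a i) (Suc d)" using a(2)[OF i] .
    fix j assume j: "j < s" and "i \<noteq> j"
    have aI: "a i \<in> I ^^^ 1" "a j \<in> I ^^^ 1" using a(1) i j ideal_power_1[OF I] by auto
    have "v i \<otimes> v j \<in> Z (2 * d)" using assms i j \<open>i \<noteq> j\<close> unfolding orthogonal_def by blast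
    from Z_mult[OF this pow_mult_mem[OF aI]] have "(v i \<otimes> v j) \<otimes> (a i \<otimes> a j) \<in> Z (2 * Suc d)" by simp
    also have "(v i \<otimes> v j) \<otimes> (a i \<otimes> a j) = (v i \<otimes> a i) \<otimes> (v j \<otimes> a j)"
      using pow_carrier[OF v(1)[OF i]] pow_carrier[OF v(1)[OF j]] pow_carrier[OF aI(1)] pow_carrier[OF aI(2)]
      by algebra
    finally show "(v i \<otimes> a i) \<otimes> (v j \<otimes> a j) \<in> Z (2 * Suc d)" .
  qed simp
  thus ?thesis by blast
qed

lemma orthogonal_raise:
  assumes "orthogonal s d v" "d \<le> d'"
  shows "\<exists>v'. orthogonal s d' v'"
  using assms(2)
proof (induction d' rule: dec_induct)
  case base thus ?case using assms(1) by blast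
next
  case (step n) thus ?case using orthogonal_Suc by blast
qed

lemma exists_orthogonal_sum:
  assumes "orthogonal s d v"
  shows "\<exists>x\<in>I ^^^ d. \<forall>i<s. x \<otimes> v i \<ominus> v i \<otimes> v i \<in> Z (2 * d)"
proof -
  have v: "v i \<in> I ^^^ d" "v i \<in> carrier R" if "i < s" for i
    using assms that pow_carrier unfolding orthogonal_def by blast+
  have vv: "v i \<otimes> v j \<in> Z (2 * d)" if "i < s" "j < s" "i \<noteq> j" for i j
    using assms that unfolding orthogonal_def by blast
  \<comment> \<open>Here \<open>x\<close> is the partial sum \<open>v 0 + ... + v (t - 1)\<close>;
    the second conjunct records that the terms not yet added annihilate it.\<close>
  have "\<exists>x\<in>I ^^^ d. \<forall>i<s. (i < t \<longrightarrow> x \<otimes> v i \<ominus> v i \<otimes> v i \<in> Z (2 * d)) \<and> (t \<le> i \<longrightarrow> x \<otimes> v i \<in> Z (2 * d))"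
    if "t \<le> s" for t
    using that
  proof (induction t)
    case 0
    have "\<zero> \<in> I ^^^ d" using ideal_zero_mem[OF ideal_power_ideal[OF I]] .
    moreover have "\<zero> \<otimes> v i \<in> Z (2 * d)" if "i < s" for i using v(2)[OF that] ideal_zero_mem[OF Z_ideal] by simp
    ultimately show ?case by auto
  next
    case (Suc t)
    then obtain x where x: "x \<in> I ^^^ d" "\<And>i. i < s \<Longrightarrow> i < t \<Longrightarrow> x \<otimes> v i \<ominus> v i \<otimes> v i \<in> Z (2 * d)"
      "\<And>i. i < s \<Longrightarrow> t \<le> i \<Longrightarrow> x \<otimes> v i \<in> Z (2 * d)" by auto
    have t: "t < s" using Suc.prems by simp
    have xc: "x \<in> carrier R" using pow_carrier[OF x(1)] .
    have "x \<oplus> v t \<in> I ^^^ d" using ideal_add_mem[OF ideal_power_ideal[OF I] x(1) v(1)[OF t]] .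
    moreover have "(x \<oplus> v t) \<otimes> v i \<ominus> v i \<otimes> v i \<in> Z (2 * d)" if i: "i < s" "i < Suc t" for i
    proof (cases "i = t")
      case True
      have "(x \<oplus> v t) \<otimes> v i \<ominus> v i \<otimes> v i = x \<otimes> v t" using True xc v(2)[OF t] by algebra
      thus ?thesis using x(3)[OF t] by simp
    next
      case False
      have "(x \<oplus> v t) \<otimes> v i \<ominus> v i \<otimes> v i = (x \<otimes> v i \<ominus> v i \<otimes> v i) \<oplus> v t \<otimes> v i"
        using xc v(2)[OF t] v(2)[OF i(1)] by algebra
      thus ?thesis using x(2)[OF i(1)] vv[OF t i(1)] False i ideal_add_mem[OF Z_ideal] by simp
    qed
    moreover have "(x \<oplus> v t) \<otimes> v i \<in> Z (2 * d)" if i: "i < s" "Suc t \<le> i" for i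
    proof -
      have "(x \<oplus> v t) \<otimes> v i = x \<otimes> v i \<oplus> v t \<otimes> v i" using xc v(2)[OF t] v(2)[OF i(1)] by (simp add: l_distr)
      thus ?thesis using x(3)[OF i(1)] vv[OF t i(1)] i ideal_add_mem[OF Z_ideal] by simp
    qed
    ultimately show ?case by blast
  qed
  from this[of s] show ?thesis by blast
qed

text \<open>Modulo \<open>Z\<close>, \<open>x^k v i\<close> equals \<open>v i^(k+1)\<close>, so
  \<open>x^k w = 0\<close> makes \<open>w\<close> orthogonal to every \<open>v i^(k+1)\<close>. Were
  \<open>w\<close> not nilpotent, powers of the \<open>v i\<close> and of \<open>w\<close> would
  form an orthogonal family with \<open>s + 1\<close> members.\<close>

lemma nil_if_annihilated:
  assumes o: "orthogonal s d v" and max: "\<And>d' v'. \<not> orthogonal (Suc s) d' v'"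
    and x: "x \<in> I ^^^ d" "\<And>i. i < s \<Longrightarrow> x \<otimes> v i \<ominus> v i \<otimes> v i \<in> Z (2 * d)"
    and w: "w \<in> I ^^^ n" "0 < n" "x [^] (k::nat) \<otimes> w \<in> Z (k * d + n)"
  shows "nil w n"
proof (rule ccontr)
  assume nn: "\<not> nil w n"
  have v: "v i \<in> I ^^^ d" "v i \<in> carrier R" "\<not> nil (v i) d" if "i < s" for i
    using o that pow_carrier unfolding orthogonal_def by blast+
  have vv: "v i \<otimes> v j \<in> Z (2 * d)" if "i < s" "j < s" "i \<noteq> j" for i j
    using o that unfolding orthogonal_def by blast
  have d: "0 < d" using o unfolding orthogonal_def by blast
  have c: "x \<in> carrier R" "w \<in> carrier R" using pow_carrier[OF x(1)] pow_carrier[OF w(1)] by auto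
  have xpow: "x [^] m \<otimes> v i \<ominus> v i [^] Suc m \<in> Z (Suc m * d)" if i: "i < s" for i and m :: nat
  proof (induction m)
    case 0
    have "x [^] (0::nat) \<otimes> v i \<ominus> v i [^] Suc 0 = \<zero>" using v(2)[OF i] by (simp add: r_neg a_minus_def)
    thus ?case using ideal_zero_mem[OF Z_ideal] by simp
  next
    case (Suc m)
    let ?p = "x [^] m" and ?q = "v i [^] m"
    have pq: "?p \<in> carrier R" "?q \<in> carrier R" using c v(2)[OF i] by auto
    have "x \<otimes> (?p \<otimes> v i \<ominus> v i [^] Suc m) \<oplus> ?q \<otimes> (x \<otimes> v i \<ominus> v i \<otimes> v i) \<in> Z (Suc (Suc m) * d)"
    proof (rule ideal_add_mem[OF Z_ideal])
      show "x \<otimes> (?p \<otimes> v i \<ominus> v i [^] Suc m) \<in> Z (Suc (Suc m) * d)"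
        using Z_mult'[OF x(1) Suc.IH] by simp
      show "?q \<otimes> (x \<otimes> v i \<ominus> v i \<otimes> v i) \<in> Z (Suc (Suc m) * d)"
        using Z_mult'[OF pow_pow_mem[OF v(1)[OF i], of m] x(2)[OF i]] by (simp add: algebra_simps mult_2_right)
    qed
    also have "x \<otimes> (?p \<otimes> v i \<ominus> v i [^] Suc m) \<oplus> ?q \<otimes> (x \<otimes> v i \<ominus> v i \<otimes> v i) =
        x [^] Suc m \<otimes> v i \<ominus> v i [^] Suc (Suc m)"
      unfolding nat_pow_Suc using pq c v(2)[OF i] by algebra
    finally show ?case .
  qed
  \<comment> \<open>The powers \<open>v i^((k+1) n)\<close> and \<open>w^((k+1) d)\<close> share the
    degree \<open>?E\<close>. Since \<open>n\<close> and \<open>d\<close> are positive, they contain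
    the factors \<open>v i^(k+1)\<close> and \<open>w\<close>, whose product vanishes.\<close>
  let ?E = "(k + 1) * n * d"
  define u where "u i = (if i < s then v i [^] ((k + 1) * n) else w [^] ((k + 1) * d))" for i
  have vw: "v i [^] ((k + 1) * n) \<otimes> w [^] ((k + 1) * d) \<in> Z (2 * ?E)" if i: "i < s" for i
  proof -
    have "v i [^] Suc k \<otimes> w \<in> Z (Suc k * d + n)"
    proof -
      have 1: "(x [^] k \<otimes> w) \<otimes> v i \<in> Z (k * d + n + d)" using Z_mult[OF w(3) v(1)[OF i]] .
      have 2: "(x [^] k \<otimes> v i \<ominus> v i [^] Suc k) \<otimes> w \<in> Z (Suc k * d + n)" using Z_mult[OF xpow[OF i] w(1)] .
      have "k * d + n + d = Suc k * d + n" by simp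
      hence "(x [^] k \<otimes> w) \<otimes> v i \<ominus> (x [^] k \<otimes> v i \<ominus> v i [^] Suc k) \<otimes> w \<in> Z (Suc k * d + n)"
        using ideal_minus_mem[OF Z_ideal _ 2] 1 by metis
      moreover have "x [^] k \<in> carrier R" "v i [^] Suc k \<in> carrier R" using c v(2)[OF i] by auto
      hence "(x [^] k \<otimes> w) \<otimes> v i \<ominus> (x [^] k \<otimes> v i \<ominus> v i [^] Suc k) \<otimes> w = v i [^] Suc k \<otimes> w"
        using c v(2)[OF i] by algebra
      ultimately show ?thesis by simp
    qed
    moreover have "v i [^] ((k + 1) * (n - 1)) \<otimes> w [^] ((k + 1) * d - 1) \<in>
        I ^^^ ((k + 1) * (n - 1) * d + ((k + 1) * d - 1) * n)"
      by (intro pow_mult_mem pow_pow_mem v(1) i w(1))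
    ultimately have "(v i [^] Suc k \<otimes> w) \<otimes> (v i [^] ((k + 1) * (n - 1)) \<otimes> w [^] ((k + 1) * d - 1)) \<in>
        Z (Suc k * d + n + ((k + 1) * (n - 1) * d + ((k + 1) * d - 1) * n))" by (rule Z_mult)
    moreover have "Suc k * d + n + ((k + 1) * (n - 1) * d + ((k + 1) * d - 1) * n) = 2 * ?E"
    proof -
      have "Suc k * d + (k + 1) * (n - 1) * d = ?E" using w(2) by (cases n) (auto simp: algebra_simps)
      moreover have "n + ((k + 1) * d - 1) * n = ?E" using d by (cases d) (auto simp: algebra_simps)
      ultimately show ?thesis by linarith
    qed
    moreover have "v i [^] ((k + 1) * n) = v i [^] Suc k \<otimes> v i [^] ((k + 1) * (n - 1))"
    proof -
      have "(k + 1) * n = Suc k + (k + 1) * (n - 1)" using w(2) by (cases n) auto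
      thus ?thesis using v(2)[OF i] nat_pow_mult[of "v i" "Suc k" "(k + 1) * (n - 1)"] by simp
    qed
    moreover have "w [^] ((k + 1) * d) = w \<otimes> w [^] ((k + 1) * d - 1)"
    proof -
      have "(k + 1) * d = Suc 0 + ((k + 1) * d - 1)" using d by (cases d) auto
      thus ?thesis using c nat_pow_mult[of w "Suc 0" "(k + 1) * d - 1"] by simp
    qed
    moreover have "(v i [^] Suc k \<otimes> p) \<otimes> (w \<otimes> q) = (v i [^] Suc k \<otimes> w) \<otimes> (p \<otimes> q)"
      if "p \<in> carrier R" "q \<in> carrier R" for p q
    proof -
      have "v i [^] Suc k \<in> carrier R" using v(2)[OF i] by simp
      thus ?thesis using that c by algebra
    qed
    hence "(v i [^] Suc k \<otimes> v i [^] ((k + 1) * (n - 1))) \<otimes> (w \<otimes> w [^] ((k + 1) * d - 1)) =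
      (v i [^] Suc k \<otimes> w) \<otimes> (v i [^] ((k + 1) * (n - 1)) \<otimes> w [^] ((k + 1) * d - 1))"
      using v(2)[OF i] c by blast
    ultimately show ?thesis by metis
  qed
  have "orthogonal (Suc s) ?E u" unfolding orthogonal_def
  proof (intro conjI allI impI)
    show "0 < ?E" using d w(2) by simp
    fix i assume i: "i < Suc s"
    have E: "?E = (k + 1) * d * n" by (simp add: algebra_simps)
    show "u i \<in> I ^^^ ?E"
      using pow_pow_mem[OF v(1), of i "(k + 1) * n"] pow_pow_mem[OF w(1), of "(k + 1) * d"] E
      by (simp only: u_def split: if_split) blast
    show "\<not> nil (u i) ?E"
    proof (cases "i < s")
      case True
      thus ?thesis using nil_if_nil_pow[OF v(2)[OF True]] v(3)[OF True] by (auto simp: u_def)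
    next
      case False
      thus ?thesis using nil_if_nil_pow[OF c(2), of "(k + 1) * d" n] nn
        by (simp only: u_def E if_False) blast
    qed
    fix j assume j: "j < Suc s" and ij: "i \<noteq> j"
    consider "i < s" "j < s" | "i < s" "j = s" | "i = s" "j < s" using i j ij by linarith
    thus "u i \<otimes> u j \<in> Z (2 * ?E)"
    proof cases
      case 1
      have "(v i \<otimes> v j) [^] ((k + 1) * n) \<in> Z ((k + 1) * n * (2 * d))"
        using vv[OF 1 ij] w(2) by (intro pow_mem_Z) auto
      moreover have "(k + 1) * n * (2 * d) = 2 * ?E" by simp
      ultimately have "(v i \<otimes> v j) [^] ((k + 1) * n) \<in> Z (2 * ?E)" by metis
      thus ?thesis using 1 v(2)[OF 1(1)] v(2)[OF 1(2)] by (simp add: u_def nat_pow_distrib)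
    next
      case 2
      thus ?thesis using vw[OF 2(1)] by (simp add: u_def)
    next
      case 3
      have "u i \<otimes> u j = u j \<otimes> u i" using 3 c v(2)[OF 3(2)] by (simp add: u_def m_comm)
      thus ?thesis using vw[OF 3(2)] 3 by (simp add: u_def)
    qed
  qed
  thus False using max by blast
qed

text \<open>The descending chain \<open>x\<^sup>j I\<^sup>(\<^sup>e\<^sup>+\<^sup>1\<^sup>-\<^sup>j\<^sup>)\<^sup>d + Z\<close>, \<open>j = 0, \<dots>, e + 1\<close>, has a repetition, because the fiber in degree
  \<open>(e + 1) d\<close> has length at most \<open>e\<close>.  Since \<open>I\<^sup>m\<^sup>+\<^sup>t = I\<^sup>m I\<^sup>t\<close>, the repetition propagates to all higher degrees.\<close>

lemma fitting_step:
  assumes x: "x \<in> I ^^^ d"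
  shows "\<exists>n0. \<forall>n\<ge>n0. \<forall>y\<in>I ^^^ (n + d). \<exists>u\<in>I ^^^ n. x [^] e \<otimes> y \<ominus> x [^] Suc e \<otimes> u \<in> Z (e * d + n + d)"
proof -
  have xc: "x \<in> carrier R" using pow_carrier[OF x] .
  define Q where "Q j = scale (x [^] j) (I ^^^ ((Suc e - j) * d)) <+> Z (Suc e * d)" for j
  have iS: "ideal (scale (x [^] (j::nat)) (I ^^^ m)) R" for j m using xc I by (intro scale_ideal) auto
  have iQ: "ideal (Q j) R" "Z (Suc e * d) \<subseteq> Q j" for j
    unfolding Q_def using add_ideals[OF iS Z_ideal] add_right_subset[OF iS Z_ideal] by auto
  have Qle: "Q j \<subseteq> I ^^^ (Suc e * d)" if "j \<le> Suc e" for j unfolding Q_def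
  proof (intro add_ideals_least Z_subset ideal_power_ideal I image_subsetI)
    fix b assume "b \<in> I ^^^ ((Suc e - j) * d)"
    from pow_mult_mem[OF pow_pow_mem[OF x, of j] this] have "x [^] j \<otimes> b \<in> I ^^^ (j * d + (Suc e - j) * d)" .
    moreover have "j * d + (Suc e - j) * d = Suc e * d" using that by (metis add_mult_distrib le_add_diff_inverse)
    ultimately show "x [^] j \<otimes> b \<in> I ^^^ (Suc e * d)" by metis
  qed
  have Qdec: "Q (Suc j) \<subseteq> Q j" if "j \<le> e" for j unfolding Q_def[of "Suc j"]
  proof (intro add_ideals_least iQ image_subsetI)
    fix b assume b: "b \<in> I ^^^ ((Suc e - Suc j) * d)"
    have "x \<otimes> b \<in> I ^^^ (d + (Suc e - Suc j) * d)" using pow_mult_mem[OF x b] .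
    moreover have "d + (Suc e - Suc j) * d = (Suc e - j) * d" using that by (simp add: Suc_diff_le)
    ultimately have "x \<otimes> b \<in> I ^^^ ((Suc e - j) * d)" by metis
    moreover have "x [^] Suc j \<otimes> b = x [^] j \<otimes> (x \<otimes> b)" using xc pow_carrier[OF b] by (simp add: m_assoc)
    ultimately have "x [^] Suc j \<otimes> b \<in> scale (x [^] j) (I ^^^ ((Suc e - j) * d))" by blast
    thus "x [^] Suc j \<otimes> b \<in> Q j" unfolding Q_def using add_left_subset[OF iS Z_ideal] by blast
  qed
  have "\<exists>j\<le>e. Q j = Q (Suc j)"
  proof (rule ccontr)
    assume ne: "\<not> ?thesis"
    \<comment> \<open>Reversing the index makes the descending chain ascend; \<open>e + 1\<close>
      strict steps are one more than the fiber allows.\<close>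
    have "enat (Suc e) \<le> len (Z (Suc e * d)) (I ^^^ (Suc e * d))" unfolding len_def
    proof (rule le_chain_heightI[of _ "\<lambda>i. Q (Suc e - i)"])
      fix i assume "i \<le> Suc e"
      thus "Q (Suc e - i) \<in> ideals_between (Z (Suc e * d)) (I ^^^ (Suc e * d))"
        using iQ Qle[of "Suc e - i"] by (simp add: ideals_between_iff)
    next
      fix i assume i: "i < Suc e"
      hence "Q (Suc (e - i)) \<subset> Q (e - i)" using Qdec[of "e - i"] ne by (metis diff_le_self psubsetI)
      thus "Q (Suc e - i) \<subset> Q (Suc e - Suc i)" using i by (simp add: Suc_diff_le)
    qed
    also have "\<dots> \<le> enat e" unfolding Z_def by (rule len_fiber_le)
    finally show False by simp
  qed
  then obtain j where j: "j \<le> e" "Q j = Q (Suc j)" by blast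
  \<comment> \<open>The repetition says that
    \<open>x^j I^((a+1)d) \<subseteq> x^(j+1) I^(ad) + Z\<close>. Multiplying by \<open>x^a\<close>
    raises the exponents of \<open>x\<close> to \<open>e\<close> and \<open>e + 1\<close>, whatever
    \<open>j\<close> is.\<close>
  define a where "a = e - j"
  have ja: "j + a = e" "Suc e - j = Suc a" "Suc e - Suc j = a" using j(1) by (auto simp: a_def)
  have "\<exists>u\<in>I ^^^ n. x [^] e \<otimes> y \<ominus> x [^] Suc e \<otimes> u \<in> Z (e * d + n + d)"
    if n: "n \<ge> a * d" and y: "y \<in> I ^^^ (n + d)" for n y
  proof -
    define t where "t = n - a * d"
    have nt: "n = a * d + t" using n by (simp add: t_def)
    let ?B = "scale (x [^] Suc e) (I ^^^ n) <+> Z (e * d + n + d)"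
    have iB: "ideal ?B R" by (intro add_ideals iS Z_ideal)
    have xec: "x [^] e \<in> carrier R" using xc by simp
    have "(I ^^^ (Suc a * d)) \<cdot> (I ^^^ t) \<subseteq> colon ?B (x [^] e)"
    proof (rule ideal_prod_least[OF colon_ideal[OF xec iB]])
      fix p b assume p: "p \<in> I ^^^ (Suc a * d)" and b: "b \<in> I ^^^ t"
      have "x [^] j \<otimes> p \<in> Q j" unfolding Q_def ja(2) using add_left_subset[OF iS Z_ideal] p by blast
      hence "x [^] j \<otimes> p \<in> Q (Suc j)" using j(2) by simp
      then obtain u \<zeta> where u: "u \<in> I ^^^ (a * d)" "\<zeta> \<in> Z (Suc e * d)" "x [^] j \<otimes> p = x [^] Suc j \<otimes> u \<oplus> \<zeta>"
        unfolding Q_def ja(3) by (auto elim!: set_add_memE)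
      have car: "p \<in> carrier R" "b \<in> carrier R" "u \<in> carrier R" "\<zeta> \<in> carrier R"
        "x [^] j \<in> carrier R" "x [^] a \<in> carrier R"
        using pow_carrier p b u Z_carrier xc by auto
      have xe: "x [^] e = x [^] j \<otimes> x [^] a" using nat_pow_mult[OF xc, of j a] ja(1) by simp
      have "x [^] e \<otimes> (p \<otimes> b) = x [^] a \<otimes> (x [^] j \<otimes> p) \<otimes> b" unfolding xe using car by algebra
      also have "\<dots> = x [^] Suc e \<otimes> (u \<otimes> b) \<oplus> (x [^] a \<otimes> \<zeta>) \<otimes> b"
        unfolding u(3) nat_pow_Suc xe using car xc by algebra
      also have "\<dots> \<in> ?B"
      proof (rule set_add_memI)
        show "x [^] Suc e \<otimes> (u \<otimes> b) \<in> scale (x [^] Suc e) (I ^^^ n)"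
          using pow_mult_mem[OF u(1) b] nt by blast
        have "(x [^] a \<otimes> \<zeta>) \<otimes> b \<in> Z (a * d + Suc e * d + t)"
          by (intro Z_mult Z_mult' pow_pow_mem x u b)
        moreover have "a * d + Suc e * d + t = e * d + n + d" by (simp add: nt)
        ultimately show "(x [^] a \<otimes> \<zeta>) \<otimes> b \<in> Z (e * d + n + d)" by metis
      qed
      finally show "p \<otimes> b \<in> colon ?B (x [^] e)" using car by (simp add: colon_def)
    qed
    moreover have "n + d = Suc a * d + t" by (simp add: nt)
    hence "y \<in> (I ^^^ (Suc a * d)) \<cdot> (I ^^^ t)" using y ideal_power_add[OF I] by metis
    ultimately have "y \<in> colon ?B (x [^] e)" by (rule subsetD)
    hence "x [^] e \<otimes> y \<in> ?B" by (simp add: colon_def)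
    then obtain u \<zeta> where u: "u \<in> I ^^^ n" "\<zeta> \<in> Z (e * d + n + d)" "x [^] e \<otimes> y = x [^] Suc e \<otimes> u \<oplus> \<zeta>"
      by (auto elim!: set_add_memE)
    have "x [^] Suc e \<in> carrier R" using xc by simp
    hence "x [^] e \<otimes> y \<ominus> x [^] Suc e \<otimes> u = \<zeta>"
      unfolding u(3) using pow_carrier[OF u(1)] Z_carrier[OF u(2)] by algebra
    thus ?thesis using u by metis
  qed
  thus ?thesis by blast
qed

text \<open>Iterating \<open>fitting_step\<close> \<open>l\<close> times: each round lowers the
  degree of the second factor by \<open>d\<close> in exchange for one more power of
  \<open>x\<close>. The same \<open>n0\<close> serves all rounds.\<close>

lemma fitting:
  assumes x: "x \<in> I ^^^ d"
  shows "\<exists>n0. \<forall>y\<in>I ^^^ (n0 + l * d). \<exists>u\<in>I ^^^ n0. x [^] e \<otimes> y \<ominus> x [^] (e + l) \<otimes> u \<in> Z (e * d + n0 + l * d)"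
proof -
  have xc: "x \<in> carrier R" using pow_carrier[OF x] .
  obtain n0 where n0: "\<And>n y. n \<ge> n0 \<Longrightarrow> y \<in> I ^^^ (n + d) \<Longrightarrow>
      \<exists>u\<in>I ^^^ n. x [^] e \<otimes> y \<ominus> x [^] Suc e \<otimes> u \<in> Z (e * d + n + d)"
    using fitting_step[OF x] by blast
  have "\<exists>u\<in>I ^^^ n0. x [^] e \<otimes> y \<ominus> x [^] (e + l) \<otimes> u \<in> Z (e * d + n0 + l * d)"
    if "y \<in> I ^^^ (n0 + l * d)" for y
    using that
  proof (induction l arbitrary: y)
    case 0
    hence y: "y \<in> I ^^^ n0" by simp
    have "x [^] e \<otimes> y \<in> carrier R" using xc pow_carrier[OF y] by simp
    hence "x [^] e \<otimes> y \<ominus> x [^] (e + 0) \<otimes> y = \<zero>" by (simp add: a_minus_def r_neg)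
    thus ?case using ideal_zero_mem[OF Z_ideal] y by metis
  next
    case (Suc l)
    have "n0 + Suc l * d = n0 + l * d + d" by simp
    then obtain u where u: "u \<in> I ^^^ (n0 + l * d)"
      "x [^] e \<otimes> y \<ominus> x [^] Suc e \<otimes> u \<in> Z (e * d + (n0 + l * d) + d)"
      using n0[of "n0 + l * d" y] Suc.prems by (metis le_add1)
    obtain t where t: "t \<in> I ^^^ n0" "x [^] e \<otimes> u \<ominus> x [^] (e + l) \<otimes> t \<in> Z (e * d + n0 + l * d)"
      using Suc.IH[OF u(1)] by blast
    have car: "y \<in> carrier R" "u \<in> carrier R" "t \<in> carrier R" "x [^] e \<in> carrier R" "x [^] (e + l) \<in> carrier R"
      using pow_carrier[OF Suc.prems] pow_carrier[OF u(1)] pow_carrier[OF t(1)] xc by auto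
    have 1: "x \<otimes> (x [^] e \<otimes> u \<ominus> x [^] (e + l) \<otimes> t) \<in> Z (e * d + n0 + Suc l * d)"
      using Z_mult'[OF x t(2)] by (simp add: algebra_simps)
    have 2: "x [^] e \<otimes> y \<ominus> x [^] Suc e \<otimes> u \<in> Z (e * d + n0 + Suc l * d)"
      using u(2) by (simp add: algebra_simps)
    have "(x [^] e \<otimes> y \<ominus> x [^] Suc e \<otimes> u) \<oplus> x \<otimes> (x [^] e \<otimes> u \<ominus> x [^] (e + l) \<otimes> t) =
        x [^] e \<otimes> y \<ominus> (x [^] (e + l) \<otimes> x) \<otimes> t"
      unfolding nat_pow_Suc using car xc by algebra
    also have "x [^] (e + l) \<otimes> x = x [^] (e + Suc l)" by simp
    finally show ?case using ideal_add_mem[OF Z_ideal 2 1] t(1) by metis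
  qed
  thus ?thesis by blast
qed

text \<open>In the degree \<open>?n\<close> chosen below, every \<open>y\<close> splits into a
  multiple of \<open>x\<close> and a part killed by \<open>x^e\<close> modulo \<open>Z\<close>,
  which is nilpotent by \<open>nil_if_annihilated\<close>. So \<open>I\<close> is nilpotent modulo
  \<open>x\<close> in the fiber cone, and Nakayama's lemma removes the term
  \<open>\<mm> I^(p+d)\<close>.\<close>

lemma exists_principal_reduction:
  assumes o: "orthogonal s d v" and max: "\<And>d' v'. \<not> orthogonal (Suc s) d' v'"
  shows "\<exists>x\<in>carrier R. \<exists>n1. \<forall>n\<ge>n1. I ^^^ (n + d) = scale x (I ^^^ n)"
proof -
  have d: "0 < d" using o unfolding orthogonal_def by blast
  obtain x where x: "x \<in> I ^^^ d" "\<And>i. i < s \<Longrightarrow> x \<otimes> v i \<ominus> v i \<otimes> v i \<in> Z (2 * d)"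
    using exists_orthogonal_sum[OF o] by blast
  have xc: "x \<in> carrier R" using pow_carrier[OF x(1)] .
  \<comment> \<open>This is the ideal generated by \<open>x\<close> in the fiber cone. For
    \<open>n < d\<close> the truncated subtraction gives \<open>V n = xR + Z n\<close>, which need
    not lie in \<open>I^n\<close>; \<open>V_mult\<close> still holds because
    \<open>m + n - d \<le> (m - d) + n\<close>.\<close>
  define V where "V n = scale x (I ^^^ (n - d)) <+> Z n" for n
  have iS: "ideal (scale x (I ^^^ m)) R" for m using xc I by (intro scale_ideal) auto
  have V: "ideal (V n) R" for n unfolding V_def by (intro add_ideals iS Z_ideal)
  have V_mult: "a \<otimes> b \<in> V (m + n)" if a: "a \<in> V m" and b: "b \<in> I ^^^ n" for a b m n
  proof -
    obtain u \<zeta> where u: "u \<in> I ^^^ (m - d)" "\<zeta> \<in> Z m" "a = x \<otimes> u \<oplus> \<zeta>"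
      using a unfolding V_def by (auto elim!: set_add_memE)
    have "a \<otimes> b = x \<otimes> (u \<otimes> b) \<oplus> \<zeta> \<otimes> b"
      unfolding u(3) using xc pow_carrier[OF u(1)] Z_carrier[OF u(2)] pow_carrier[OF b] by algebra
    moreover have "u \<otimes> b \<in> I ^^^ (m + n - d)"
      using subsetD[OF ideal_power_antimono[OF I] pow_mult_mem[OF u(1) b], of "m + n - d"] by simp
    ultimately show ?thesis unfolding V_def using Z_mult[OF u(2) b] by (auto intro: set_add_memI)
  qed
  obtain n0 where n0: "\<And>y. y \<in> I ^^^ (n0 + Suc e * d) \<Longrightarrow>
      \<exists>u\<in>I ^^^ n0. x [^] e \<otimes> y \<ominus> x [^] (e + Suc e) \<otimes> u \<in> Z (e * d + n0 + Suc e * d)"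
    using fitting[OF x(1), of "Suc e"] by blast
  let ?n = "n0 + Suc e * d"
  have nil_mod: "\<exists>p::nat. y [^] p \<in> V (p * ?n)" if y: "y \<in> I ^^^ ?n" for y
  proof -
    obtain u where u: "u \<in> I ^^^ n0" "x [^] e \<otimes> y \<ominus> x [^] (e + Suc e) \<otimes> u \<in> Z (e * d + n0 + Suc e * d)"
      using n0[OF y] by blast
    have car: "y \<in> carrier R" "u \<in> carrier R" "x [^] e \<in> carrier R"
      using pow_carrier[OF y] pow_carrier[OF u(1)] xc by auto
    \<comment> \<open>By the choice of \<open>u\<close>, \<open>x^e w = x^e y - x^(2e+1) u\<close>
      lies in \<open>Z\<close>, while the subtracted \<open>x^(e+1) u\<close> is a multiple of
      \<open>x\<close> in the same degree as \<open>y\<close>.\<close>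
    define w where "w = y \<ominus> x \<otimes> (x [^] e \<otimes> u)"
    have xeu: "x [^] e \<otimes> u \<in> I ^^^ (e * d + n0)" by (intro pow_mult_mem pow_pow_mem x u)
    have "x \<otimes> (x [^] e \<otimes> u) \<in> I ^^^ (d + (e * d + n0))" by (rule pow_mult_mem[OF x(1) xeu])
    moreover have dn: "d + (e * d + n0) = ?n" by simp
    ultimately have xxeu: "x \<otimes> (x [^] e \<otimes> u) \<in> I ^^^ ?n" by metis
    have w: "w \<in> I ^^^ ?n" unfolding w_def by (rule ideal_minus_mem[OF ideal_power_ideal[OF I] y xxeu])
    have wc: "w \<in> carrier R" using pow_carrier[OF w] .
    have "x [^] (e + Suc e) = x [^] e \<otimes> (x [^] e \<otimes> x)" using nat_pow_mult[OF xc, of e "Suc e"] by simp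
    hence "x [^] e \<otimes> w = x [^] e \<otimes> y \<ominus> x [^] (e + Suc e) \<otimes> u" unfolding w_def using car xc by algebra
    hence xw: "x [^] e \<otimes> w \<in> Z (e * d + ?n)" using u(2) by (simp add: add.assoc)
    have "nil w ?n"
    proof (rule nil_if_annihilated[OF o max x(1) _ w _ xw])
      show "x \<otimes> v i \<ominus> v i \<otimes> v i \<in> Z (2 * d)" if "i < s" for i using x(2)[OF that] .
    qed (use d in simp)
    then obtain p :: nat where p: "w [^] p \<in> Z (p * ?n)" unfolding nil_def by blast
    have yw: "y \<ominus> w \<in> V ?n"
    proof -
      have "y \<ominus> w = x \<otimes> (x [^] e \<otimes> u)" unfolding w_def using car xc by algebra
      moreover have "?n - d = e * d + n0" using dn by linarith
      hence "x \<otimes> (x [^] e \<otimes> u) \<in> scale x (I ^^^ (?n - d))" using xeu by (metis imageI)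
      ultimately show ?thesis unfolding V_def using add_left_subset[OF iS Z_ideal] by auto
    qed
    \<comment> \<open>Since \<open>y\<close> and \<open>w\<close> agree modulo \<open>V\<close>, so
      do their powers, by telescoping; nilpotency thus passes from \<open>w\<close> to
      \<open>y\<close>.\<close>
    have diff: "y [^] q \<ominus> w [^] q \<in> V (q * ?n)" for q :: nat
    proof (induction q)
      case 0
      show ?case using ideal_zero_mem[OF V] by (simp add: a_minus_def r_neg)
    next
      case (Suc q)
      have qc: "y [^] q \<in> carrier R" "w [^] q \<in> carrier R" using car wc by auto
      have "(y [^] q \<ominus> w [^] q) \<otimes> y \<oplus> (y \<ominus> w) \<otimes> w [^] q \<in> V (Suc q * ?n)"
      proof (rule ideal_add_mem[OF V])
        show "(y [^] q \<ominus> w [^] q) \<otimes> y \<in> V (Suc q * ?n)" using V_mult[OF Suc.IH y] by (simp add: add_ac)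
        show "(y \<ominus> w) \<otimes> w [^] q \<in> V (Suc q * ?n)" using V_mult[OF yw pow_pow_mem[OF w, of q]] by (simp add: add_ac)
      qed
      moreover have "(y [^] q \<ominus> w [^] q) \<otimes> y \<oplus> (y \<ominus> w) \<otimes> w [^] q = y [^] Suc q \<ominus> w [^] Suc q"
        unfolding nat_pow_Suc using qc car wc by algebra
      ultimately show ?case by simp
    qed
    have "w [^] p \<in> V (p * ?n)" unfolding V_def using p add_right_subset[OF iS Z_ideal] by blast
    hence "y [^] p \<in> V (p * ?n)" using add_minus_cancel_mem[OF V diff[of p]] car(1) by simp
    thus ?thesis by blast
  qed
  have "\<exists>p. I ^^^ p \<subseteq> V p"
  proof (rule ideal_power_subset_if_pow_mem[OF I V])
    show "a \<otimes> b \<in> V (Suc n)" if "a \<in> V n" "b \<in> I" for a b n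
      using V_mult[OF that(1), of b 1] that(2) ideal_power_1[OF I] by simp
    show "\<exists>p::nat. a [^] p \<in> V p" if a: "a \<in> I" for a
    proof -
      \<comment> \<open>As \<open>nil_mod\<close> concerns degree \<open>?n\<close> only, the
        \<open>?n\<close>-th power of \<open>a\<close> is taken first.\<close>
      have "a [^] ?n \<in> I ^^^ ?n" using pow_pow_mem[of a 1 ?n] a ideal_power_1[OF I] by simp
      then obtain p :: nat where "(a [^] ?n) [^] p \<in> V (p * ?n)" using nil_mod by blast
      hence "a [^] (?n * p) \<in> V (?n * p)" using nat_pow_pow[OF ideal.Icarr[OF I a], of ?n p] by (metis mult.commute)
      thus ?thesis by blast
    qed
  qed
  then obtain p where p: "I ^^^ p \<subseteq> V p" by blast
  \<comment> \<open>Passing from \<open>p\<close> to \<open>p + d\<close> makes the subtraction in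
    \<open>V\<close> exact.\<close>
  have "I ^^^ (p + d) \<subseteq> V (p + d)" unfolding ideal_power_add[OF I]
    using p V_mult by (intro ideal_prod_least V) blast
  hence "I ^^^ (p + d) \<subseteq> scale x (I ^^^ p) <+> \<mm> \<cdot> (I ^^^ (p + d))" unfolding V_def Z_def by simp
  moreover have sub: "scale x (I ^^^ m) \<subseteq> I ^^^ (m + d)" for m
    unfolding add.commute[of m d] using pow_mult_mem[OF x(1)] by auto
  ultimately have eq: "I ^^^ (p + d) = scale x (I ^^^ p)"
    using nakayama[OF ideal_power_ideal[OF I] iS] by blast
  have "I ^^^ (n + d) = scale x (I ^^^ n)" if n: "n \<ge> p" for n
  proof (rule subset_antisym[OF _ sub])
    have "(I ^^^ (p + d)) \<cdot> (I ^^^ (n - p)) \<subseteq> scale x (I ^^^ n)"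
    proof (rule ideal_prod_least[OF iS])
      fix a b assume "a \<in> I ^^^ (p + d)" and b: "b \<in> I ^^^ (n - p)"
      then obtain u where u: "u \<in> I ^^^ p" "a = x \<otimes> u" using eq by auto
      have "a \<otimes> b = x \<otimes> (u \<otimes> b)" unfolding u(2) using xc pow_carrier[OF u(1)] pow_carrier[OF b] by (simp add: m_assoc)
      moreover have "u \<otimes> b \<in> I ^^^ n" using pow_mult_mem[OF u(1) b] n by simp
      ultimately show "a \<otimes> b \<in> scale x (I ^^^ n)" by blast
    qed
    moreover have "n + d = p + d + (n - p)" using n by simp
    ultimately show "I ^^^ (n + d) \<subseteq> scale x (I ^^^ n)"
      using ideal_power_add[OF I] by metis
  qed
  thus ?thesis using xc by blast
qed

text \<open>The empty family and the bound \<open>orthogonal_le\<close> give a maximal size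
  \<open>s\<close>. By \<open>orthogonal_raise\<close> it is attained in every degree from
  \<open>d0\<close> on, which makes consecutive values of \<open>d\<close> available.\<close>

lemma eventually_principal_reduction:
  "\<exists>d0. \<forall>d\<ge>d0. \<exists>x\<in>carrier R. \<exists>n1. \<forall>n\<ge>n1. I ^^^ (n + d) = scale x (I ^^^ n)"
proof -
  let ?P = "\<lambda>s. \<exists>d v. orthogonal s d v"
  have "?P 0" unfolding orthogonal_def by auto
  then obtain s where s: "?P s" "\<And>t. ?P t \<Longrightarrow> t \<le> s"
    using ex_has_greatest_nat[of ?P 0 id "Suc e"] orthogonal_le by (auto simp: less_Suc_eq_le)
  hence max: "\<not> orthogonal (Suc s) d' v'" for d' v' using s(2)[of "Suc s"] not_less_eq_eq by blast
  obtain d0 v where o: "orthogonal s d0 v" using s(1) by blast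
  show ?thesis using orthogonal_raise[OF o] exists_principal_reduction[OF _ max] by blast
qed

end

section \<open>Linear growth\<close>

text \<open>The least value \<open>h m\<close> beyond \<open>n1\<close> is not exceeded at any
  \<open>m + a d + b (d + 1)\<close>, and every number from \<open>d^2\<close> on has the form
  \<open>a d + b (d + 1)\<close>.\<close>

lemma eventually_constant_if_two_steps:
  fixes h :: "nat \<Rightarrow> nat"
  assumes "\<And>n. n \<ge> n1 \<Longrightarrow> h (n + d) \<le> h n" "\<And>n. n \<ge> n1 \<Longrightarrow> h (n + Suc d) \<le> h n"
  shows "\<exists>c N. \<forall>n\<ge>N. h n = c"
proof -
  obtain m where m: "m \<ge> n1" "\<And>n. n \<ge> n1 \<Longrightarrow> h m \<le> h n"
    using ex_has_least_nat[of "\<lambda>n. n \<ge> n1" n1 h] by auto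
  have 1: "h (m + a * d) \<le> h m" for a
  proof (induction a)
    case (Suc a)
    have "h (m + a * d + d) \<le> h (m + a * d)" using m(1) by (intro assms(1)) simp
    thus ?case using Suc by (simp add: add_ac)
  qed simp
  have 2: "h (m + a * d + b * Suc d) \<le> h m" for a b
  proof (induction b)
    case (Suc b)
    have "h (m + a * d + b * Suc d + Suc d) \<le> h (m + a * d + b * Suc d)" using m(1) by (intro assms(2)) simp
    thus ?case using Suc by (simp add: add_ac)
  qed (use 1 in simp)
  have "h n = h m" if n: "n \<ge> m + d * d" for n
  proof -
    define k where "k = n - m"
    have k: "n = m + k" "k \<ge> d * d" using n by (auto simp: k_def)
    have "\<exists>a b. k = a * d + b * Suc d"
    proof (cases "d = 0")
      case True
      thus ?thesis by (intro exI[of _ 0] exI[of _ k]) simp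
    next
      case False
      \<comment> \<open>Writing \<open>k = q d + r\<close> with \<open>q \<ge> d > r\<close> gives
        \<open>k = (q - r) d + r (d + 1)\<close>.\<close>
      have "d \<le> k div d" using k(2) False by (simp add: less_eq_div_iff_mult_less_eq)
      moreover have "k mod d < d" using False by simp
      ultimately have "k mod d \<le> k div d" by simp
      then obtain t where t: "k div d = k mod d + t" using le_Suc_ex by blast
      have "k = (k div d) * d + k mod d" by simp
      also have "\<dots> = t * d + (k mod d) * Suc d" unfolding t by (simp add: algebra_simps)
      finally show ?thesis by blast
    qed
    then obtain a b where "n = m + a * d + b * Suc d" using k(1) by auto
    hence "h n \<le> h m" using 2 by simp
    thus ?thesis using m(2)[of n] k(1) m(1) by auto
  qed
  thus ?thesis by blast
qed

context local_ring_with_parameter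
begin

lemma len_sat_power_eventually_linear:
  assumes I: "ideal I R"
  shows "\<exists>a b :: int. \<exists>N. \<forall>n\<ge>N. \<exists>l. len (I ^^^ n) (sat (I ^^^ n)) = enat l \<and> int l = a * int n + b"
proof -
  define e where "e = the_enat (len (scale z (carrier R)) (carrier R))"
  have e: "len (scale z (carrier R)) (carrier R) = enat e" unfolding e_def using len_parameter_finite by auto
  interpret bounded_fiber_cone R \<mm> I e
  proof (intro bounded_fiber_cone.intro bounded_fiber_cone_axioms.intro)
    show "noetherian_local_ring R \<mm>" by (rule noetherian_local_ring_axioms)
    show "ideal I R" by (rule I)
    show "len (\<mm> \<cdot> (I ^^^ n)) (I ^^^ n) \<le> enat e" for n
      using len_max_mult_le[OF ideal_power_ideal[OF I], of n] unfolding e .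
  qed
  have ip: "ideal (I ^^^ n) R" for n by (simp add: I)
  obtain n0 where n0: "\<And>n. n \<ge> n0 \<Longrightarrow> sat (I ^^^ n) = sat (I ^^^ n0)"
    using sat_stabilizes[of "\<lambda>n. I ^^^ n"] ip ideal_power_antimono[OF I] by blast
  let ?S = "sat (I ^^^ n0)"
  have S: "ideal ?S R" using sat_ideal[OF ip] .
  have sub: "I ^^^ n \<subseteq> ?S" if "n \<ge> n0" for n using subset_sat[OF ip, of n] n0[OF that] by simp
  define L where "L n = the_enat (len (I ^^^ n) ?S)" for n
  have L: "len (I ^^^ n) ?S = enat (L n)" if "n \<ge> n0" for n
    unfolding L_def using len_finite[OF ip S sub[OF that]] n0[OF that] by auto
  \<comment> \<open>Below \<open>n0\<close> this length may be infinite and \<open>h n\<close>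
    unspecified; all bounds on \<open>h\<close> start at \<open>n0\<close> or later.\<close>
  define h where "h n = the_enat (len (I ^^^ Suc n) (I ^^^ n))" for n
  have dec: "I ^^^ Suc n \<subseteq> I ^^^ n" for n by (intro ideal_power_antimono I) simp
  have split: "len (I ^^^ Suc n) ?S = len (I ^^^ Suc n) (I ^^^ n) + len (I ^^^ n) ?S" if "n \<ge> n0" for n
    by (rule len_add[OF ip ip S dec sub[OF that]])
  have h: "len (I ^^^ Suc n) (I ^^^ n) = enat (h n)" if "n \<ge> n0" for n
    using split[OF that] L[of "Suc n"] L[OF that] that unfolding h_def
    by (cases "len (I ^^^ Suc n) (I ^^^ n)") auto
  have Lh: "L (Suc n) = h n + L n" if "n \<ge> n0" for n
    using split[OF that] L[of "Suc n"] L[OF that] h[OF that] that by simp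
  obtain d where d: "\<And>d'. d' \<ge> d \<Longrightarrow> \<exists>x\<in>carrier R. \<exists>n1. \<forall>n\<ge>n1. I ^^^ (n + d') = scale x (I ^^^ n)"
    using eventually_principal_reduction by blast
  have step: "\<exists>n1. \<forall>n\<ge>n1. h (n + d') \<le> h n" if d': "d' \<ge> d" for d'
  proof -
    obtain x n1 where x: "x \<in> carrier R" "\<And>n. n \<ge> n1 \<Longrightarrow> I ^^^ (n + d') = scale x (I ^^^ n)"
      using d[OF d'] by blast
    have "h (n + d') \<le> h n" if n: "n \<ge> max n0 n1" for n
    proof -
      have "enat (h (n + d')) = len (I ^^^ (Suc n + d')) (I ^^^ (n + d'))" using h[of "n + d'"] n by simp
      also have "\<dots> = len (scale x (I ^^^ Suc n)) (scale x (I ^^^ n))" using x(2)[of n] x(2)[of "Suc n"] n by simp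
      also have "\<dots> \<le> len (I ^^^ Suc n) (I ^^^ n)" by (rule len_scale_le[OF x(1) ip ip dec])
      also have "\<dots> = enat (h n)" using h[of n] n by simp
      finally show ?thesis by simp
    qed
    thus ?thesis by blast
  qed
  obtain n1 where n1: "\<And>n. n \<ge> n1 \<Longrightarrow> h (n + d) \<le> h n" using step[of d] by blast
  obtain n2 where n2: "\<And>n. n \<ge> n2 \<Longrightarrow> h (n + Suc d) \<le> h n" using step[of "Suc d"] by auto
  obtain c N0 where c: "\<And>n. n \<ge> N0 \<Longrightarrow> h n = c"
    using eventually_constant_if_two_steps[of "max n1 n2" h d] n1 n2 by auto
  define N where "N = max n0 N0"
  have lin: "L (N + k) = L N + k * c" for k
  proof (induction k)
    case (Suc k)
    thus ?case using Lh[of "N + k"] c[of "N + k"] by (simp add: N_def)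
  qed simp
  have "len (I ^^^ n) (sat (I ^^^ n)) = enat (L n) \<and> int (L n) = int c * int n + (int (L N) - int c * int N)"
    if n: "n \<ge> N" for n
  proof
    show "len (I ^^^ n) (sat (I ^^^ n)) = enat (L n)" using L[of n] n0[of n] n by (simp add: N_def)
    obtain k where "n = N + k" using n le_Suc_ex by blast
    thus "int (L n) = int c * int n + (int (L N) - int c * int N)"
      using lin[of k] by (simp add: algebra_simps)
  qed
  thus ?thesis by blast
qed

end

theorem theorem4p3:
  fixes R :: "('a, 'b) ring_scheme" (structure)
  assumes "local_ring R \<mm>"
    and "noetherian_ring R"
    and "krull_dim R = 1"
    and "ideal I R"
  shows "\<exists>a b :: int. \<exists>N :: nat. \<forall>n\<ge>N. \<exists>l :: nat.
    module_length R (local_cohomology0 R \<mm> (quot_module R (I [^]\<^bsub>ideals_set R\<^esub> n))) = enat l \<and>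
    int l = a * int n + b"
proof -
  interpret local_ring R \<mm> by fact
  interpret noetherian_ring R by fact
  interpret noetherian_local_ring R \<mm> by unfold_locales
  have prime_le: "P \<subseteq> \<mm>" if "primeideal P R" for P
    using proper_ideal_subset_max[OF primeideal.axioms(1)[OF that]] primeideal.I_notcarr[OF that] by auto
  \<comment> \<open>Otherwise \<open>Q \<subset> P \<subset> \<mm>\<close> would be a chain of
    primes of length 2, against dimension one.\<close>
  have "Q = P" if P: "primeideal P R" "P \<noteq> \<mm>" "primeideal Q R" "Q \<subseteq> P" for P Q
  proof (rule ccontr)
    assume "Q \<noteq> P"
    let ?C = "\<lambda>i::nat. if i = 0 then Q else if i = 1 then P else \<mm>"
    have "primeideal \<mm> R" by (rule maximalideal_prime[OF is_maximalideal])
    have "enat 2 \<le> krull_dim R" unfolding krull_dim_def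
    proof (rule le_chain_heightI[of 2 ?C])
      show "?C i \<in> {P. primeideal P R}" for i using P \<open>primeideal \<mm> R\<close> by simp
      show "?C i \<subset> ?C (Suc i)" if "i < 2" for i
        using P \<open>Q \<noteq> P\<close> prime_le[OF P(1)] that by (auto simp: less_2_cases_iff)
    qed
    thus False using assms(3) by (simp add: one_enat_def)
  qed
  then obtain z c where "z \<in> \<mm>" "\<mm> ^^^ c \<subseteq> scale z (carrier R)" using exists_parameter by blast
  then interpret local_ring_with_parameter R \<mm> z c by unfold_locales
  from len_sat_power_eventually_linear[OF assms(4)] show ?thesis
    using module_length_local_cohomology0[OF ideal_power_ideal[OF assms(4)]] by (simp add: ideal_power_def)
qed

end
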